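(* Let $\Gamma:J^1\pi\to J^2\pi$ be a second order connection, let $(\varphi,v)$ be a pair consisting of a non-vanishing closed $1$-form $\varphi$ and a vector field $v$ on $X$ with $i_v\varphi=1$, let $Z:V\to J^1\pi$ ($V\subset Y$ open) be a local connection embedded in $\Gamma$, and let $A_Z$ be its directional shape operator. If $\tilde\Omega$ is a $\Gamma$-compatible volume for $D_Z$, then $$\mathcal{L}_{Z_v}\tilde\Omega=(\mathrm{Tr}\,A_Z)\,\tilde\Omega .$$
   Context: All objects are smooth; summation convention over repeated indices is used. $\pi:Y\to X$ is a fibred manifold with $\dim X=n>1$, $\dim Y=n+m$; $\pi_1:J^1\pi\to X$, $\pi_{1,0}:J^1\pi\to Y$, $J^2\pi$ are the jet bundles, with fibred coordinates $(x^i,y^\sigma)$, $(x^i,y^\sigma,y^\sigma_j)$, $(x^i,y^\sigma,y^\sigma_j,y^\sigma_{jk})$. $V\pi$, $V\pi_{1,0}$ are the vertical bundles of $\pi$, $\pi_{1,0}$. $\omega^\sigma=dy^\sigma-y^\sigma_jdx^j$. Second order connection: a section $\Gamma:J^1\pi\to J^2\pi$ of $J^2\pi\to J^1\pi$, with components $F^\sigma_{ij}=y^\sigma_{ij}\circ\Gamma=F^\sigma_{ji}$. Put $\Gamma_i=\frac{\partial}{\partial x^i}+y^\sigma_i\frac{\partial}{\partial y^\sigma}+F^\sigma_{ij}\frac{\partial}{\partial y^\sigma_j}$, $D_\Gamma=\mathrm{span}\{\Gamma_i\}$. Data on $X$: $\varphi=\varphi_idx^i$ closed non-vanishing, $v=v^i\partial/\partial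 x^i$, $i_v\varphi=1$. $S^\varphi=\varphi_i\,\omega^\sigma\otimes\frac{\partial}{\partial y^\sigma_i}$, $\Gamma_v=v^i\Gamma_i$. The endomorphism $\mathcal{L}_{\Gamma_v}S^\varphi$ of $TJ^1\pi$ has eigenvalues $0,1,-1$ with eigendistributions $\mathcal{D}_0$, $\mathcal{D}_+=\mathrm{span}\{\varphi_i\partial/\partial y^\sigma_i\}$ and $H=\mathrm{span}\{H_\sigma=\frac{\partial}{\partial y^\sigma}+H^\nu_{\sigma k}\frac{\partial}{\partial y^\nu_k}\}$ (the last formula defines $H^\nu_{\sigma k}$), and $TJ^1\pi=D_\Gamma\oplus H\oplus(\mathcal{D}_0\cap V\pi_{1,0})\oplus\mathcal{D}_+$. $\mathcal{Q}_+$ is the projector onto $\mathcal{D}_+$ in this splitting, $\mathcal{Q}_+=v^k\psi^\sigma_k\otimes\varphi_i\frac{\partial}{\partial y^\sigma_i}$ with $\psi^\nu_k=dy^\nu_k-F^\nu_{ki}dx^i-H^\nu_{\sigma k}\omega^\sigma$. In coordinates adapted so that $\varphi=dx^1$, $v^1=1$ (indices $p,q$ from $2$ to $n$): $H^\nu_{\sigma1}=\frac12\bigl(\frac{\partial F^\nu_{11}}{\partial y^\sigma_1}-v^pv^q\frac{\partial F^\nu_{pq}}{\partial y^\sigma_1}\bigr)$, $H^\nu_{\sigma p}=v^k\frac{\partial F^\nu_{pk}}{\partial y^\sigma_1}$. Embedded connection: a local connection is a local section $Z:V\to J^1\pi$ of $\pi_{1,0}$, with components $Z^\sigma_i=y^\sigma_i\circ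 Z$, $Z_i=\frac{\partial}{\partial x^i}+Z^\sigma_i\frac{\partial}{\partial y^\sigma}$, $D_Z=\mathrm{span}\{Z_i\}$, $\bar\omega^\sigma=dy^\sigma-Z^\sigma_jdx^j$, $Z_v=v^iZ_i$. It is embedded in $\Gamma$ if $T_yZ(D_Z(y))\subset D_\Gamma(Z(y))$ for all $y\in V$. Shape operator: let $s:\mathcal{D}_+\to V\pi$ be the fibrewise isomorphism with $s(\varphi_i\partial/\partial y^\sigma_i|_{p})=\partial/\partial y^\sigma|_{\pi_{1,0}(p)}$. $A_Z$ is the vector-valued $1$-form on $V$ given by $A_Z(y)(\xi)=s_{Z(y)}\bigl(\mathcal{Q}_+(TZ(\xi))\bigr)$. In coordinates $A_Z=A^\sigma_\nu\,\bar\omega^\nu\otimes\frac{\partial}{\partial y^\sigma}$, $A^\sigma_\nu=v^i\bigl(\frac{\partial Z^\sigma_i}{\partial y^\nu}-H^\sigma_{\nu i}\circ Z\bigr)$; $\mathrm{Tr}\,A_Z=A^\sigma_\sigma$. A characterising $m$-form for $D_Z$ is a nowhere vanishing $m$-form annihilated by contraction with every vector in $D_Z$ (equivalently, locally a nowhere zero function multiple of $\bar\omega^1\wedge\dots\wedge\bar\omega^m$). A characterising $m$-form $\tilde\Omega$ is a $\Gamma$-compatible volume if $\mathcal{L}_{Z_v}\tilde\Omega=i_{A_Z}\tilde\Omega$, where for vector-valued forms $i_{\alpha\otimes\xi}\Omega=\alpha\wedge i_\xi\Omega$. *)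

theory Defs
  imports "HOL-Analysis.Analysis"
begin

section \<open>Smooth maps and vector calculus on open sets of Euclidean spaces\<close>

text \<open>The predicates below are meant for open sets.\<close>

primrec Ck_on :: "nat \<Rightarrow> 'a::euclidean_space set \<Rightarrow> ('a \<Rightarrow> 'b::euclidean_space) \<Rightarrow> bool" where
  "Ck_on 0 S f \<longleftrightarrow> continuous_on S f"
| "Ck_on (Suc k) S f \<longleftrightarrow>
     f differentiable_on S \<and> (\<forall>w. Ck_on k S (\<lambda>a. frechet_derivative f (at a) w))"

definition smooth_on :: "'a::euclidean_space set \<Rightarrow> ('a \<Rightarrow> 'b::euclidean_space) \<Rightarrow> bool" where
  "smooth_on S f \<longleftrightarrow> open S \<and> (\<forall>k. Ck_on k S f)"

definition lie_bracket :: "('a::euclidean_space \<Rightarrow> 'a) \<Rightarrow> ('a \<Rightarrow> 'a) \<Rightarrow> 'a \<Rightarrow> 'a" where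
  "lie_bracket W U a = frechet_derivative U (at a) (W a) - frechet_derivative W (at a) (U a)"

text \<open>Lie derivative of a field of endomorphisms, \<open>(L\<^sub>W S) U = [W, S U] - S [W, U]\<close>. It is
  tensorial in \<open>U\<close>, so at a point it is evaluated on the constant extension of a vector.\<close>

definition lie_endo ::
  "('a::euclidean_space \<Rightarrow> 'a) \<Rightarrow> ('a \<Rightarrow> 'a \<Rightarrow> 'a) \<Rightarrow> 'a \<Rightarrow> 'a \<Rightarrow> 'a" where
  "lie_endo W S a w = lie_bracket W (\<lambda>b. S b w) a - S a (lie_bracket W (\<lambda>b. w) a)"

definition eigendistribution :: "('a::real_vector \<Rightarrow> 'a) \<Rightarrow> real \<Rightarrow> 'a set" where
  "eigendistribution h r = {w. h w = r *\<^sub>R w}"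

text \<open>Exterior forms of degree \<open>k\<close> take a sequence of vectors, of which only those with index
  below \<open>k\<close> matter.\<close>

definition alt_form :: "nat \<Rightarrow> ((nat \<Rightarrow> 'a::real_vector) \<Rightarrow> real) \<Rightarrow> bool" where
  "alt_form k f \<longleftrightarrow>
     (\<forall>\<xi> \<xi>'. (\<forall>i<k. \<xi> i = \<xi>' i) \<longrightarrow> f \<xi> = f \<xi>') \<and>
     (\<forall>\<xi>. \<forall>i<k. linear (\<lambda>w. f (\<xi>(i := w)))) \<and>
     (\<forall>\<xi>. \<forall>i<k. \<forall>j<k. i \<noteq> j \<and> \<xi> i = \<xi> j \<longrightarrow> f \<xi> = 0)"

definition contract :: "'a \<Rightarrow> ((nat \<Rightarrow> 'a) \<Rightarrow> real) \<Rightarrow> (nat \<Rightarrow> 'a) \<Rightarrow> real" where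
  "contract w f \<xi> = f (case_nat w \<xi>)"

text \<open>Wedge product of a 1-form with a \<open>k\<close>-form.\<close>

definition wedge1 ::
  "nat \<Rightarrow> ('a \<Rightarrow> real) \<Rightarrow> ((nat \<Rightarrow> 'a) \<Rightarrow> real) \<Rightarrow> (nat \<Rightarrow> 'a) \<Rightarrow> real" where
  "wedge1 k \<alpha> f \<xi> =
     (\<Sum>i\<le>k. (- 1) ^ i * \<alpha> (\<xi> i) * f (\<lambda>j. if j < i then \<xi> j else \<xi> (Suc j)))"

text \<open>Insertion of a vector-valued 1-form \<open>A\<close> into an \<open>m\<close>-form (\<open>m \<ge> 1\<close>): the linear extension
  of \<open>i\<^bsub>\<alpha>\<otimes>b\<^esub> f = \<alpha> \<and> i\<^sub>b f\<close>, applied to \<open>A = \<Sum>\<^sub>b (A \<bullet> b) \<otimes> b\<close>, where \<open>b\<close> runs over the standard basis.\<close>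

definition insert_vform ::
  "nat \<Rightarrow> ('a::euclidean_space \<Rightarrow> 'a) \<Rightarrow> ((nat \<Rightarrow> 'a) \<Rightarrow> real) \<Rightarrow> (nat \<Rightarrow> 'a) \<Rightarrow> real" where
  "insert_vform m A f \<xi> =
     (\<Sum>b\<in>Basis. wedge1 (m - 1) (\<lambda>w. A w \<bullet> b) (contract b f) \<xi>)"

text \<open>Lie derivative of an \<open>m\<close>-form:
  \<open>(L\<^sub>W \<Omega>)(\<xi>\<^sub>0,\<dots>) = W(\<Omega>(\<xi>\<^sub>0,\<dots>)) - \<Sum>\<^sub>i \<Omega>(\<dots>,[W,\<xi>\<^sub>i],\<dots>)\<close>, on constant vector fields \<open>\<xi>\<^sub>i\<close>.\<close>

definition lie_form ::
  "nat \<Rightarrow> ('a::euclidean_space \<Rightarrow> 'a) \<Rightarrow> ('a \<Rightarrow> (nat \<Rightarrow> 'a) \<Rightarrow> real) \<Rightarrow> 'a \<Rightarrow> (nat \<Rightarrow> 'a) \<Rightarrow> real" where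
  "lie_form m W \<Omega> a \<xi> =
     frechet_derivative (\<lambda>b. \<Omega> b \<xi>) (at a) (W a)
     - (\<Sum>i<m. \<Omega> a (\<xi>(i := lie_bracket W (\<lambda>b. \<xi> i) a)))"


section \<open>Fibred manifolds\<close>

text \<open>A fibred chart has domain \<open>cdom c\<close> in the total space, base coordinates \<open>xc c = (x\<^sup>i)\<close>
  on the projection of \<open>cdom c\<close>, and fibre coordinates \<open>yc c = (y\<^sup>\<sigma>)\<close> on \<open>cdom c\<close>. The index \<open>i\<close> ranges
  over the finite type \<open>'n\<close> and \<open>\<sigma>\<close> over the finite type \<open>'m\<close>.\<close>

record ('x, 'y, 'n::finite, 'm::finite) fchart =
  cdom :: "'y set"
  xc :: "'x \<Rightarrow> real^'n"
  yc :: "'y \<Rightarrow> real^'m"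

record ('x, 'y, 'n::finite, 'm::finite) fibred_space =
  base :: "'x topology"
  tot :: "'y topology"
  proj :: "'y \<Rightarrow> 'x"
  charts :: "('x, 'y, 'n, 'm) fchart set"

type_synonym ('n, 'm) ycoord = "(real^'n) \<times> (real^'m)"

text \<open>Coordinates \<open>(x\<^sup>i, y\<^sup>\<sigma>, y\<^sup>\<sigma>\<^sub>i)\<close> on the first jet bundle, with \<open>y\<^sup>\<sigma>\<^sub>i = u $ \<sigma> $ i\<close>.\<close>

type_synonym ('n, 'm) jcoord = "(real^'n) \<times> (real^'m) \<times> (real^'n^'m)"

definition bdom :: "('x,'y,'n::finite,'m::finite) fibred_space \<Rightarrow> ('x,'y,'n,'m) fchart \<Rightarrow> 'x set" where
  "bdom M c = proj M ` cdom c"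

definition totc ::
  "('x,'y,'n::finite,'m::finite) fibred_space \<Rightarrow> ('x,'y,'n,'m) fchart \<Rightarrow> 'y \<Rightarrow> ('n,'m) ycoord" where
  "totc M c y = (xc c (proj M y), yc c y)"

definition xinv ::
  "('x,'y,'n::finite,'m::finite) fibred_space \<Rightarrow> ('x,'y,'n,'m) fchart \<Rightarrow> real^'n \<Rightarrow> 'x" where
  "xinv M c = inv_into (bdom M c) (xc c)"

definition totinv ::
  "('x,'y,'n::finite,'m::finite) fibred_space \<Rightarrow> ('x,'y,'n,'m) fchart \<Rightarrow> ('n,'m) ycoord \<Rightarrow> 'y" where
  "totinv M c = inv_into (cdom c) (totc M c)"

definition fibred_manifold :: "('x,'y,'n::finite,'m::finite) fibred_space \<Rightarrow> bool" where
  "fibred_manifold M \<longleftrightarrow>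
     Hausdorff_space (base M) \<and> second_countable (base M) \<and>
     Hausdorff_space (tot M) \<and> second_countable (tot M) \<and>
     proj M ` topspace (tot M) = topspace (base M) \<and>
     \<Union> (cdom ` charts M) = topspace (tot M) \<and>
     (\<forall>c\<in>charts M.
        openin (tot M) (cdom c) \<and> openin (base M) (bdom M c) \<and>
        open (totc M c ` cdom c) \<and> open (xc c ` bdom M c) \<and>
        homeomorphic_map (subtopology (tot M) (cdom c)) (top_of_set (totc M c ` cdom c)) (totc M c) \<and>
        homeomorphic_map (subtopology (base M) (bdom M c)) (top_of_set (xc c ` bdom M c)) (xc c)) \<and>
     (\<forall>c\<in>charts M. \<forall>c'\<in>charts M.
        smooth_on (totc M c ` (cdom c \<inter> cdom c')) (totc M c' \<circ> totinv M c) \<and>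
        smooth_on (xc c ` (bdom M c \<inter> bdom M c')) (xc c' \<circ> xinv M c))"

text \<open>Vector fields, 1-forms and (below) \<open>m\<close>-forms are given by their component functions in every
  chart, related by the tensorial transformation laws.\<close>

definition base_vector_field ::
  "('x,'y,'n::finite,'m::finite) fibred_space \<Rightarrow> (('x,'y,'n,'m) fchart \<Rightarrow> real^'n \<Rightarrow> real^'n) \<Rightarrow> bool" where
  "base_vector_field M v \<longleftrightarrow>
     (\<forall>c\<in>charts M. smooth_on (xc c ` bdom M c) (v c)) \<and>
     (\<forall>c\<in>charts M. \<forall>c'\<in>charts M. \<forall>x \<in> bdom M c \<inter> bdom M c'.
        v c' (xc c' x) = frechet_derivative (xc c' \<circ> xinv M c) (at (xc c x)) (v c (xc c x)))"

definition base_one_form ::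
  "('x,'y,'n::finite,'m::finite) fibred_space \<Rightarrow> (('x,'y,'n,'m) fchart \<Rightarrow> real^'n \<Rightarrow> real^'n) \<Rightarrow> bool" where
  "base_one_form M \<phi> \<longleftrightarrow>
     (\<forall>c\<in>charts M. smooth_on (xc c ` bdom M c) (\<phi> c)) \<and>
     (\<forall>c\<in>charts M. \<forall>c'\<in>charts M. \<forall>x \<in> bdom M c \<inter> bdom M c'. \<forall>w.
        \<phi> c (xc c x) \<bullet> w =
        \<phi> c' (xc c' x) \<bullet> frechet_derivative (xc c' \<circ> xinv M c) (at (xc c x)) w)"

definition closed_form ::
  "('x,'y,'n::finite,'m::finite) fibred_space \<Rightarrow> (('x,'y,'n,'m) fchart \<Rightarrow> real^'n \<Rightarrow> real^'n) \<Rightarrow> bool" where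
  "closed_form M \<phi> \<longleftrightarrow> (\<forall>c\<in>charts M. \<forall>a \<in> xc c ` bdom M c. \<forall>i j.
     frechet_derivative (\<lambda>b. \<phi> c b $ j) (at a) (axis i 1) =
     frechet_derivative (\<lambda>b. \<phi> c b $ i) (at a) (axis j 1))"

definition nonvanishing_form ::
  "('x,'y,'n::finite,'m::finite) fibred_space \<Rightarrow> (('x,'y,'n,'m) fchart \<Rightarrow> real^'n \<Rightarrow> real^'n) \<Rightarrow> bool" where
  "nonvanishing_form M \<phi> \<longleftrightarrow> (\<forall>c\<in>charts M. \<forall>a \<in> xc c ` bdom M c. \<phi> c a \<noteq> 0)"


section \<open>Jets\<close>

definition sec_rep ::
  "('x,'y,'n::finite,'m::finite) fibred_space \<Rightarrow> ('x,'y,'n,'m) fchart \<Rightarrow> ('x \<Rightarrow> 'y) \<Rightarrow> real^'n \<Rightarrow> real^'m" where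
  "sec_rep M c \<gamma> a = yc c (\<gamma> (xinv M c a))"

text \<open>\<open>\<gamma>\<close> restricts to a smooth local section on some neighbourhood of \<open>x\<close>; its values elsewhere are
  irrelevant.\<close>

definition local_section ::
  "('x,'y,'n::finite,'m::finite) fibred_space \<Rightarrow> 'x \<Rightarrow> ('x \<Rightarrow> 'y) \<Rightarrow> bool" where
  "local_section M x \<gamma> \<longleftrightarrow> x \<in> topspace (base M) \<and> \<gamma> x \<in> topspace (tot M) \<and>
     (\<forall>c\<in>charts M. \<gamma> x \<in> cdom c \<longrightarrow>
        (\<exists>U. openin (base M) U \<and> x \<in> U \<and> (\<forall>z\<in>U. \<gamma> z \<in> cdom c \<and> proj M (\<gamma> z) = z) \<and>
             smooth_on (xc c ` U) (sec_rep M c \<gamma>)))"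

definition d1 ::
  "('x,'y,'n::finite,'m::finite) fibred_space \<Rightarrow> ('x,'y,'n,'m) fchart \<Rightarrow> 'x \<Rightarrow> ('x \<Rightarrow> 'y) \<Rightarrow> real^'n^'m" where
  "d1 M c x \<gamma> = (\<chi> \<sigma> i. frechet_derivative (\<lambda>a. sec_rep M c \<gamma> a $ \<sigma>) (at (xc c x)) (axis i 1))"

definition d2 ::
  "('x,'y,'n::finite,'m::finite) fibred_space \<Rightarrow> ('x,'y,'n,'m) fchart \<Rightarrow> 'x \<Rightarrow> ('x \<Rightarrow> 'y) \<Rightarrow> real^'n^'n^'m" where
  "d2 M c x \<gamma> = (\<chi> \<sigma> i j. frechet_derivative
     (\<lambda>a. frechet_derivative (\<lambda>b. sec_rep M c \<gamma> b $ \<sigma>) (at a) (axis i 1)) (at (xc c x)) (axis j 1))"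

text \<open>A jet is its source \<open>x\<close> together with a contact class of local sections around \<open>x\<close>.\<close>

type_synonym ('x, 'y) jet = "'x \<times> ('x \<Rightarrow> 'y) set"

definition jet1 ::
  "('x,'y,'n::finite,'m::finite) fibred_space \<Rightarrow> 'x \<Rightarrow> ('x \<Rightarrow> 'y) \<Rightarrow> ('x,'y) jet" where
  "jet1 M x \<gamma> = (x, {\<delta>. local_section M x \<delta> \<and> \<delta> x = \<gamma> x \<and>
     (\<forall>c\<in>charts M. \<gamma> x \<in> cdom c \<longrightarrow> d1 M c x \<delta> = d1 M c x \<gamma>)})"

definition jet2 ::
  "('x,'y,'n::finite,'m::finite) fibred_space \<Rightarrow> 'x \<Rightarrow> ('x \<Rightarrow> 'y) \<Rightarrow> ('x,'y) jet" where
  "jet2 M x \<gamma> = (x, {\<delta>. local_section M x \<delta> \<and> \<delta> x = \<gamma> x \<and>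
     (\<forall>c\<in>charts M. \<gamma> x \<in> cdom c \<longrightarrow> d1 M c x \<delta> = d1 M c x \<gamma> \<and> d2 M c x \<delta> = d2 M c x \<gamma>)})"

definition J1 :: "('x,'y,'n::finite,'m::finite) fibred_space \<Rightarrow> ('x,'y) jet set" where
  "J1 M = {jet1 M x \<gamma> | x \<gamma>. local_section M x \<gamma>}"

definition J2 :: "('x,'y,'n::finite,'m::finite) fibred_space \<Rightarrow> ('x,'y) jet set" where
  "J2 M = {jet2 M x \<gamma> | x \<gamma>. local_section M x \<gamma>}"

text \<open>The jet projections and the jet coordinates do not depend on the representative of the class;
  \<^const>\<open>the_elem\<close> extracts their common value.\<close>

definition pi10 :: "('x,'y) jet \<Rightarrow> 'y" where
  "pi10 p = the_elem ((\<lambda>\<gamma>. \<gamma> (fst p)) ` snd p)"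

definition pi21 :: "('x,'y,'n::finite,'m::finite) fibred_space \<Rightarrow> ('x,'y) jet \<Rightarrow> ('x,'y) jet" where
  "pi21 M p = the_elem (jet1 M (fst p) ` snd p)"

definition y1 ::
  "('x,'y,'n::finite,'m::finite) fibred_space \<Rightarrow> ('x,'y,'n,'m) fchart \<Rightarrow> ('x,'y) jet \<Rightarrow> real^'n^'m" where
  "y1 M c p = the_elem (d1 M c (fst p) ` snd p)"

definition y2 ::
  "('x,'y,'n::finite,'m::finite) fibred_space \<Rightarrow> ('x,'y,'n,'m) fchart \<Rightarrow> ('x,'y) jet \<Rightarrow> real^'n^'n^'m" where
  "y2 M c p = the_elem (d2 M c (fst p) ` snd p)"

definition jdom ::
  "('x,'y,'n::finite,'m::finite) fibred_space \<Rightarrow> ('x,'y,'n,'m) fchart \<Rightarrow> ('x,'y) jet set" where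
  "jdom M c = {p \<in> J1 M. pi10 p \<in> cdom c}"

definition jc ::
  "('x,'y,'n::finite,'m::finite) fibred_space \<Rightarrow> ('x,'y,'n,'m) fchart \<Rightarrow> ('x,'y) jet \<Rightarrow> ('n,'m) jcoord" where
  "jc M c p = (xc c (fst p), yc c (pi10 p), y1 M c p)"

definition jinv ::
  "('x,'y,'n::finite,'m::finite) fibred_space \<Rightarrow> ('x,'y,'n,'m) fchart \<Rightarrow> ('n,'m) jcoord \<Rightarrow> ('x,'y) jet" where
  "jinv M c = inv_into (jdom M c) (jc M c)"


section \<open>Connections\<close>

text \<open>Components \<open>F\<^sup>\<sigma>\<^sub>i\<^sub>j = conn_comp M \<Gamma> c q $ \<sigma> $ i $ j\<close> in the chart \<open>c\<close>.\<close>

definition conn_comp ::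
  "('x,'y,'n::finite,'m::finite) fibred_space \<Rightarrow> (('x,'y) jet \<Rightarrow> ('x,'y) jet) \<Rightarrow>
   ('x,'y,'n,'m) fchart \<Rightarrow> ('n,'m) jcoord \<Rightarrow> real^'n^'n^'m" where
  "conn_comp M \<Gamma> c q = y2 M c (\<Gamma> (jinv M c q))"

definition second_order_connection ::
  "('x,'y,'n::finite,'m::finite) fibred_space \<Rightarrow> (('x,'y) jet \<Rightarrow> ('x,'y) jet) \<Rightarrow> bool" where
  "second_order_connection M \<Gamma> \<longleftrightarrow>
     (\<forall>p\<in>J1 M. \<Gamma> p \<in> J2 M \<and> pi21 M (\<Gamma> p) = p) \<and>
     (\<forall>c\<in>charts M. smooth_on (jc M c ` jdom M c) (conn_comp M \<Gamma> c))"

definition loc_comp ::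
  "('x,'y,'n::finite,'m::finite) fibred_space \<Rightarrow> ('y \<Rightarrow> ('x,'y) jet) \<Rightarrow>
   ('x,'y,'n,'m) fchart \<Rightarrow> ('n,'m) ycoord \<Rightarrow> real^'n^'m" where
  "loc_comp M Z c a = y1 M c (Z (totinv M c a))"

definition local_connection ::
  "('x,'y,'n::finite,'m::finite) fibred_space \<Rightarrow> 'y set \<Rightarrow> ('y \<Rightarrow> ('x,'y) jet) \<Rightarrow> bool" where
  "local_connection M V Z \<longleftrightarrow>
     openin (tot M) V \<and> (\<forall>y\<in>V. Z y \<in> J1 M \<and> pi10 (Z y) = y) \<and>
     (\<forall>c\<in>charts M. smooth_on (totc M c ` (V \<inter> cdom c)) (loc_comp M Z c))"


section \<open>Geometry of a second order connection in a fibred chart\<close>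

text \<open>Throughout, \<open>F\<close>, \<open>v\<close>, \<open>\<phi>\<close> and \<open>\<zeta>\<close> are the components of \<open>\<Gamma>\<close>, of the vector field, of the 1-form and of
  \<open>Z\<close> in one chart. Tangent vectors of the jet bundle are triples
  \<open>(\<alpha>, \<beta>, \<eta>) = \<alpha>\<^sup>i \<partial>/\<partial>x\<^sup>i + \<beta>\<^sup>\<sigma> \<partial>/\<partial>y\<^sup>\<sigma> + \<eta>\<^sup>\<sigma>\<^sub>i \<partial>/\<partial>y\<^sup>\<sigma>\<^sub>i\<close>, those of the total space are pairs \<open>(\<alpha>, \<beta>)\<close>.\<close>

definition Gam :: "(('n::finite,'m::finite) jcoord \<Rightarrow> real^'n^'n^'m) \<Rightarrow> 'n \<Rightarrow> ('n,'m) jcoord \<Rightarrow> ('n,'m) jcoord" where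
  "Gam F i q = (axis i 1, \<chi> \<sigma>. snd (snd q) $ \<sigma> $ i, \<chi> \<sigma> j. F q $ \<sigma> $ i $ j)"

definition D_Gam :: "(('n::finite,'m::finite) jcoord \<Rightarrow> real^'n^'n^'m) \<Rightarrow> ('n,'m) jcoord \<Rightarrow> ('n,'m) jcoord set" where
  "D_Gam F q = span (range (\<lambda>i. Gam F i q))"

definition Gam_v ::
  "(('n::finite,'m::finite) jcoord \<Rightarrow> real^'n^'n^'m) \<Rightarrow> (real^'n \<Rightarrow> real^'n) \<Rightarrow> ('n,'m) jcoord \<Rightarrow> ('n,'m) jcoord" where
  "Gam_v F v q = (\<Sum>i\<in>UNIV. v (fst q) $ i *\<^sub>R Gam F i q)"

definition contact_form :: "('n::finite,'m::finite) jcoord \<Rightarrow> ('n,'m) jcoord \<Rightarrow> real^'m" where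
  "contact_form q w = (\<chi> \<sigma>. fst (snd w) $ \<sigma> - (\<Sum>j\<in>UNIV. snd (snd q) $ \<sigma> $ j * fst w $ j))"

definition S_form :: "(real^'n \<Rightarrow> real^'n) \<Rightarrow> ('n::finite,'m::finite) jcoord \<Rightarrow> ('n,'m) jcoord \<Rightarrow> ('n,'m) jcoord" where
  "S_form \<phi> q w = (0, 0, \<chi> \<sigma> i. \<phi> (fst q) $ i * contact_form q w $ \<sigma>)"

definition LS ::
  "(('n::finite,'m::finite) jcoord \<Rightarrow> real^'n^'n^'m) \<Rightarrow> (real^'n \<Rightarrow> real^'n) \<Rightarrow> (real^'n \<Rightarrow> real^'n) \<Rightarrow>
   ('n,'m) jcoord \<Rightarrow> ('n,'m) jcoord \<Rightarrow> ('n,'m) jcoord" where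
  "LS F v \<phi> = lie_endo (Gam_v F v) (S_form \<phi>)"

definition V_pi10 :: "('n::finite,'m::finite) jcoord set" where
  "V_pi10 = {w. fst w = 0 \<and> fst (snd w) = 0}"

text \<open>The projector onto the eigendistribution of \<open>1\<close> in the splitting of the tangent space into
  \<open>D\<^sub>\<Gamma>\<close>, the eigendistribution of \<open>-1\<close>, the vertical part of the kernel, and the eigendistribution of \<open>1\<close>.\<close>

definition Q_plus ::
  "(('n::finite,'m::finite) jcoord \<Rightarrow> real^'n^'n^'m) \<Rightarrow> (real^'n \<Rightarrow> real^'n) \<Rightarrow> (real^'n \<Rightarrow> real^'n) \<Rightarrow>
   ('n,'m) jcoord \<Rightarrow> ('n,'m) jcoord \<Rightarrow> ('n,'m) jcoord" where
  "Q_plus F v \<phi> q w = (THE u. u \<in> eigendistribution (LS F v \<phi> q) 1 \<and>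
     (\<exists>d \<in> D_Gam F q. \<exists>h \<in> eigendistribution (LS F v \<phi> q) (- 1).
      \<exists>k \<in> eigendistribution (LS F v \<phi> q) 0 \<inter> V_pi10. w = d + h + k + u))"

text \<open>The isomorphism onto the vertical bundle of the fibration with \<open>\<phi>\<^sub>i \<partial>/\<partial>y\<^sup>\<sigma>\<^sub>i \<mapsto> \<partial>/\<partial>y\<^sup>\<sigma>\<close>, at a jet
  over the base coordinates \<open>x\<close>.\<close>

definition s_iso ::
  "(real^'n \<Rightarrow> real^'n) \<Rightarrow> real^'n \<Rightarrow> ('n::finite,'m::finite) jcoord \<Rightarrow> ('n,'m) ycoord" where
  "s_iso \<phi> x w = (0, THE \<beta>. w = (\<Sum>\<sigma>\<in>UNIV. \<beta> $ \<sigma> *\<^sub>R (0, 0, axis \<sigma> (\<phi> x))))"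

definition Z_lift :: "(('n::finite,'m::finite) ycoord \<Rightarrow> real^'n^'m) \<Rightarrow> ('n,'m) ycoord \<Rightarrow> ('n,'m) jcoord" where
  "Z_lift \<zeta> a = (fst a, snd a, \<zeta> a)"

definition Z_vec :: "(('n::finite,'m::finite) ycoord \<Rightarrow> real^'n^'m) \<Rightarrow> 'n \<Rightarrow> ('n,'m) ycoord \<Rightarrow> ('n,'m) ycoord" where
  "Z_vec \<zeta> i a = (axis i 1, \<chi> \<sigma>. \<zeta> a $ \<sigma> $ i)"

definition D_Z :: "(('n::finite,'m::finite) ycoord \<Rightarrow> real^'n^'m) \<Rightarrow> ('n,'m) ycoord \<Rightarrow> ('n,'m) ycoord set" where
  "D_Z \<zeta> a = span (range (\<lambda>i. Z_vec \<zeta> i a))"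

definition Z_v ::
  "(('n::finite,'m::finite) ycoord \<Rightarrow> real^'n^'m) \<Rightarrow> (real^'n \<Rightarrow> real^'n) \<Rightarrow> ('n,'m) ycoord \<Rightarrow> ('n,'m) ycoord" where
  "Z_v \<zeta> v a = (\<Sum>i\<in>UNIV. v (fst a) $ i *\<^sub>R Z_vec \<zeta> i a)"

definition shape_operator ::
  "(('n::finite,'m::finite) jcoord \<Rightarrow> real^'n^'n^'m) \<Rightarrow> (real^'n \<Rightarrow> real^'n) \<Rightarrow> (real^'n \<Rightarrow> real^'n) \<Rightarrow>
   (('n,'m) ycoord \<Rightarrow> real^'n^'m) \<Rightarrow> ('n,'m) ycoord \<Rightarrow> ('n,'m) ycoord \<Rightarrow> ('n,'m) ycoord" where
  "shape_operator F v \<phi> \<zeta> a \<xi> =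
     s_iso \<phi> (fst a) (Q_plus F v \<phi> (Z_lift \<zeta> a) (frechet_derivative (Z_lift \<zeta>) (at a) \<xi>))"

text \<open>The component \<open>A\<^sup>\<sigma>\<^sub>\<nu>\<close> of \<open>A = A\<^sup>\<sigma>\<^sub>\<nu> (dy\<^sup>\<nu> - Z\<^sup>\<nu>\<^sub>j dx\<^sup>j) \<otimes> \<partial>/\<partial>y\<^sup>\<sigma>\<close> is \<open>dy\<^sup>\<sigma>(A(\<partial>/\<partial>y\<^sup>\<nu>))\<close>.\<close>

definition vform_comp :: "(('n::finite,'m::finite) ycoord \<Rightarrow> ('n,'m) ycoord) \<Rightarrow> 'm \<Rightarrow> 'm \<Rightarrow> real" where
  "vform_comp A \<sigma> \<nu> = snd (A (0, axis \<nu> 1)) $ \<sigma>"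

definition vform_trace :: "(('n::finite,'m::finite) ycoord \<Rightarrow> ('n,'m) ycoord) \<Rightarrow> real" where
  "vform_trace A = (\<Sum>\<sigma>\<in>UNIV. vform_comp A \<sigma> \<sigma>)"


section \<open>Embedded connections, shape operator and compatible volumes\<close>

definition embedded_in ::
  "('x,'y,'n::finite,'m::finite) fibred_space \<Rightarrow> (('x,'y) jet \<Rightarrow> ('x,'y) jet) \<Rightarrow>
   'y set \<Rightarrow> ('y \<Rightarrow> ('x,'y) jet) \<Rightarrow> bool" where
  "embedded_in M \<Gamma> V Z \<longleftrightarrow>
     (\<forall>c\<in>charts M. \<forall>a \<in> totc M c ` (V \<inter> cdom c).
        frechet_derivative (Z_lift (loc_comp M Z c)) (at a) ` D_Z (loc_comp M Z c) a
        \<subseteq> D_Gam (conn_comp M \<Gamma> c) (Z_lift (loc_comp M Z c) a))"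

definition A_Z ::
  "('x,'y,'n::finite,'m::finite) fibred_space \<Rightarrow> (('x,'y) jet \<Rightarrow> ('x,'y) jet) \<Rightarrow>
   (('x,'y,'n,'m) fchart \<Rightarrow> real^'n \<Rightarrow> real^'n) \<Rightarrow> (('x,'y,'n,'m) fchart \<Rightarrow> real^'n \<Rightarrow> real^'n) \<Rightarrow>
   ('y \<Rightarrow> ('x,'y) jet) \<Rightarrow> ('x,'y,'n,'m) fchart \<Rightarrow> ('n,'m) ycoord \<Rightarrow> ('n,'m) ycoord \<Rightarrow> ('n,'m) ycoord" where
  "A_Z M \<Gamma> \<phi> v Z c = shape_operator (conn_comp M \<Gamma> c) (v c) (\<phi> c) (loc_comp M Z c)"

definition m_form ::
  "('x,'y,'n::finite,'m::finite) fibred_space \<Rightarrow> 'y set \<Rightarrow>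
   (('x,'y,'n,'m) fchart \<Rightarrow> ('n,'m) ycoord \<Rightarrow> (nat \<Rightarrow> ('n,'m) ycoord) \<Rightarrow> real) \<Rightarrow> bool" where
  "m_form M V \<Omega> \<longleftrightarrow>
     (\<forall>c\<in>charts M.
        (\<forall>a \<in> totc M c ` (V \<inter> cdom c). alt_form CARD('m) (\<Omega> c a)) \<and>
        (\<forall>\<xi>. smooth_on (totc M c ` (V \<inter> cdom c)) (\<lambda>a. \<Omega> c a \<xi>))) \<and>
     (\<forall>c\<in>charts M. \<forall>c'\<in>charts M. \<forall>y \<in> V \<inter> cdom c \<inter> cdom c'. \<forall>\<xi>.
        \<Omega> c (totc M c y) \<xi> =
        \<Omega> c' (totc M c' y) (\<lambda>i. frechet_derivative (totc M c' \<circ> totinv M c) (at (totc M c y)) (\<xi> i)))"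

definition characterising_form ::
  "('x,'y,'n::finite,'m::finite) fibred_space \<Rightarrow> 'y set \<Rightarrow> ('y \<Rightarrow> ('x,'y) jet) \<Rightarrow>
   (('x,'y,'n,'m) fchart \<Rightarrow> ('n,'m) ycoord \<Rightarrow> (nat \<Rightarrow> ('n,'m) ycoord) \<Rightarrow> real) \<Rightarrow> bool" where
  "characterising_form M V Z \<Omega> \<longleftrightarrow> m_form M V \<Omega> \<and>
     (\<forall>c\<in>charts M. \<forall>a \<in> totc M c ` (V \<inter> cdom c).
        (\<exists>\<xi>. \<Omega> c a \<xi> \<noteq> 0) \<and>
        (\<forall>w \<in> D_Z (loc_comp M Z c) a. \<forall>\<xi>. contract w (\<Omega> c a) \<xi> = 0))"

text \<open>\<open>L\<^bsub>Z\<^sub>v\<^esub> \<Omega>\<close> in the chart \<open>c\<close>.\<close>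

definition lie_Zv ::
  "('x,'y,'n::finite,'m::finite) fibred_space \<Rightarrow> (('x,'y,'n,'m) fchart \<Rightarrow> real^'n \<Rightarrow> real^'n) \<Rightarrow>
   ('y \<Rightarrow> ('x,'y) jet) \<Rightarrow>
   (('x,'y,'n,'m) fchart \<Rightarrow> ('n,'m) ycoord \<Rightarrow> (nat \<Rightarrow> ('n,'m) ycoord) \<Rightarrow> real) \<Rightarrow>
   ('x,'y,'n,'m) fchart \<Rightarrow> ('n,'m) ycoord \<Rightarrow> (nat \<Rightarrow> ('n,'m) ycoord) \<Rightarrow> real" where
  "lie_Zv M v Z \<Omega> c = lie_form CARD('m) (Z_v (loc_comp M Z c) (v c)) (\<Omega> c)"

definition compatible_volume ::
  "('x,'y,'n::finite,'m::finite) fibred_space \<Rightarrow> (('x,'y) jet \<Rightarrow> ('x,'y) jet) \<Rightarrow>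
   (('x,'y,'n,'m) fchart \<Rightarrow> real^'n \<Rightarrow> real^'n) \<Rightarrow> (('x,'y,'n,'m) fchart \<Rightarrow> real^'n \<Rightarrow> real^'n) \<Rightarrow>
   'y set \<Rightarrow> ('y \<Rightarrow> ('x,'y) jet) \<Rightarrow>
   (('x,'y,'n,'m) fchart \<Rightarrow> ('n,'m) ycoord \<Rightarrow> (nat \<Rightarrow> ('n,'m) ycoord) \<Rightarrow> real) \<Rightarrow> bool" where
  "compatible_volume M \<Gamma> \<phi> v V Z \<Omega> \<longleftrightarrow> characterising_form M V Z \<Omega> \<and>
     (\<forall>c\<in>charts M. \<forall>a \<in> totc M c ` (V \<inter> cdom c). \<forall>\<xi>.
        lie_Zv M v Z \<Omega> c a \<xi> = insert_vform CARD('m) (A_Z M \<Gamma> \<phi> v Z c a) (\<Omega> c a) \<xi>)"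

end

theory Submission
  imports Defs
begin

text \<open>Since \<open>A\<^sub>Z\<close> is vertical-valued, \<open>i\<^bsub>A\<^esub> \<Omega>\<close> equals \<open>(Tr A) \<Omega>\<close> on the frames \<open>\<partial>/\<partial>y\<^sup>\<sigma>\<close>: the off-diagonal
  components of \<open>A\<close> only produce repeated arguments. To pass from these frames to arbitrary arguments,
  compatibility is used to replace \<open>i\<^bsub>A\<^esub> \<Omega>\<close> by \<open>L\<^bsub>Z\<^sub>v\<^esub> \<Omega>\<close>, which is linear in each slot and vanishes as soon
  as one argument is in \<open>D\<^sub>Z\<close>: embeddedness together with the symmetry of the components of \<open>\<Gamma>\<close> makes
  \<open>D\<^sub>Z\<close> involutive. In this way the eigenspaces of \<open>L\<^bsub>\<Gamma>\<^sub>v\<^esub> S\<^sup>\<phi>\<close> never have to be computed.\<close>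

section \<open>Symmetry of second derivatives\<close>

text \<open>The mean value theorem is applied twice: along \<open>u\<close> to a difference in
  direction \<open>w\<close>, then along \<open>w\<close> to the resulting \<open>f' _ u\<close>.
  The point \<open>p\<close> depends on \<open>h\<close>; only its distance to \<open>a\<close> is
  controlled.\<close>

lemma second_difference_mvt:
  fixes f :: "'a::real_normed_vector \<Rightarrow> real"
  assumes f: "\<And>b. b \<in> ball a r \<Longrightarrow> (f has_derivative f' b) (at b)"
    and fu: "\<And>b. b \<in> ball a r \<Longrightarrow> ((\<lambda>b. f' b u) has_derivative fu b) (at b)"
    and h: "0 < h" "h * (norm u + norm w) < r"
  obtains p where "dist p a < r"
    "f (a + h *\<^sub>R u + h *\<^sub>R w) - f (a + h *\<^sub>R u) - f (a + h *\<^sub>R w) + f a = h * (h * fu p w)"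
proof -
  have inball: "a + s *\<^sub>R u + t *\<^sub>R w \<in> ball a r" if "0 \<le> s" "s \<le> h" "0 \<le> t" "t \<le> h" for s t
  proof -
    have "norm (s *\<^sub>R u + t *\<^sub>R w) \<le> s * norm u + t * norm w"
      using norm_triangle_ineq[of "s *\<^sub>R u" "t *\<^sub>R w"] that by simp
    also have "\<dots> \<le> h * norm u + h * norm w"
      using that by (intro add_mono mult_right_mono) auto
    also have "\<dots> < r" using h by (simp add: algebra_simps)
    finally have "norm (s *\<^sub>R u + t *\<^sub>R w) < r" .
    moreover have "a - (a + s *\<^sub>R u + t *\<^sub>R w) = - (s *\<^sub>R u + t *\<^sub>R w)" by simp
    ultimately show ?thesis by (simp only: mem_ball dist_norm norm_minus_cancel)
  qed
  have lin: "linear (f' b)" "linear (fu b)" if "b \<in> ball a r" for b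
    using f[OF that] fu[OF that] has_derivative_linear by blast+
  \<comment> \<open>\<open>g h - g 0\<close> is the second difference in question, so the first mean
    value step moves only the parameter along \<open>u\<close>.\<close>
  define g where "g s = f (a + s *\<^sub>R u + h *\<^sub>R w) - f (a + s *\<^sub>R u)" for s
  have "\<exists>s\<in>{0<..<h}. g h - g 0 =
      (\<lambda>x. x * (f' (a + s *\<^sub>R u + h *\<^sub>R w) u - f' (a + s *\<^sub>R u) u)) (h - 0)"
  proof (rule mvt_simple[OF h(1)])
    fix s assume s: "0 \<le> s" "s \<le> h"
    have p: "a + s *\<^sub>R u + h *\<^sub>R w \<in> ball a r" "a + s *\<^sub>R u \<in> ball a r"
      using inball[of s h] inball[of s 0] s h by auto
    have "((\<lambda>s. f (a + s *\<^sub>R u + h *\<^sub>R w)) has_derivative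
        (\<lambda>x. f' (a + s *\<^sub>R u + h *\<^sub>R w) (x *\<^sub>R u))) (at s within {0..h})"
      by (rule has_derivative_compose[where f = "\<lambda>s. a + s *\<^sub>R u + h *\<^sub>R w" and g = f, OF _ f[OF p(1)]])
        (auto intro!: derivative_eq_intros)
    moreover have "((\<lambda>s. f (a + s *\<^sub>R u)) has_derivative (\<lambda>x. f' (a + s *\<^sub>R u) (x *\<^sub>R u)))
        (at s within {0..h})"
      by (rule has_derivative_compose[where f = "\<lambda>s. a + s *\<^sub>R u" and g = f, OF _ f[OF p(2)]])
        (auto intro!: derivative_eq_intros)
    ultimately show "(g has_derivative
        (\<lambda>x. x * (f' (a + s *\<^sub>R u + h *\<^sub>R w) u - f' (a + s *\<^sub>R u) u))) (at s within {0..h})"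
      unfolding g_def
      by (intro has_derivative_eq_rhs[OF has_derivative_diff])
        (simp_all add: linear_scale[OF lin(1)[OF p(1)]] linear_scale[OF lin(1)[OF p(2)]]
          right_diff_distrib)
  qed
  then obtain s where s: "0 < s" "s < h"
    and gs: "g h - g 0 = h * (f' (a + s *\<^sub>R u + h *\<^sub>R w) u - f' (a + s *\<^sub>R u) u)"
    by auto
  have "\<exists>t\<in>{0<..<h}. f' (a + s *\<^sub>R u + h *\<^sub>R w) u - f' (a + s *\<^sub>R u + 0 *\<^sub>R w) u =
      (\<lambda>x. x * fu (a + s *\<^sub>R u + t *\<^sub>R w) w) (h - 0)"
  proof (rule mvt_simple[OF h(1)])
    fix t assume t: "0 \<le> t" "t \<le> h"
    have p: "a + s *\<^sub>R u + t *\<^sub>R w \<in> ball a r"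
      using inball s t by simp
    have "((\<lambda>t. f' (a + s *\<^sub>R u + t *\<^sub>R w) u) has_derivative
        (\<lambda>x. fu (a + s *\<^sub>R u + t *\<^sub>R w) (x *\<^sub>R w))) (at t within {0..h})"
      by (rule has_derivative_compose[where f = "\<lambda>t. a + s *\<^sub>R u + t *\<^sub>R w" and g = "\<lambda>b. f' b u", OF _ fu[OF p]])
        (auto intro!: derivative_eq_intros)
    then show "((\<lambda>t. f' (a + s *\<^sub>R u + t *\<^sub>R w) u) has_derivative
        (\<lambda>x. x * fu (a + s *\<^sub>R u + t *\<^sub>R w) w)) (at t within {0..h})"
      by (simp add: linear_scale[OF lin(2)[OF p]])
  qed
  then obtain t where t: "0 < t" "t < h"
    and "f' (a + s *\<^sub>R u + h *\<^sub>R w) u - f' (a + s *\<^sub>R u) u = h * fu (a + s *\<^sub>R u + t *\<^sub>R w) w"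
    by auto
  with gs have "g h - g 0 = h * (h * fu (a + s *\<^sub>R u + t *\<^sub>R w) w)" by simp
  then show thesis
    using that[of "a + s *\<^sub>R u + t *\<^sub>R w"] inball[of s t] s t
    by (simp add: g_def dist_commute)
qed

text \<open>The second difference is symmetric in \<open>u\<close> and \<open>w\<close>, so its two
  mean value expressions agree at points arbitrarily close to \<open>a\<close>; continuity of both
  mixed derivatives at \<open>a\<close> carries the equality over to \<open>a\<close>.\<close>

lemma second_derivative_symmetric:
  fixes f :: "'a::real_normed_vector \<Rightarrow> real"
  assumes "open S" "a \<in> S"
    and f: "\<And>b. b \<in> S \<Longrightarrow> (f has_derivative f' b) (at b)"
    and fu: "\<And>b. b \<in> S \<Longrightarrow> ((\<lambda>b. f' b u) has_derivative fu b) (at b)"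
    and fw: "\<And>b. b \<in> S \<Longrightarrow> ((\<lambda>b. f' b w) has_derivative fw b) (at b)"
    and cu: "isCont (\<lambda>b. fu b w) a" and cw: "isCont (\<lambda>b. fw b u) a"
  shows "fu a w = fw a u"
proof (rule ccontr)
  assume "fu a w \<noteq> fw a u"
  define e where "e = \<bar>fu a w - fw a u\<bar> / 2"
  have "e > 0" using \<open>fu a w \<noteq> fw a u\<close> by (simp add: e_def)
  obtain r0 where r0: "r0 > 0" "ball a r0 \<subseteq> S"
    using assms(1,2) open_contains_ball by blast
  obtain r1 where r1: "r1 > 0" "\<And>p. dist p a < r1 \<Longrightarrow> dist (fu p w) (fu a w) < e"
    using cu \<open>e > 0\<close> unfolding continuous_at_eps_delta by blast
  obtain r2 where r2: "r2 > 0" "\<And>p. dist p a < r2 \<Longrightarrow> dist (fw p u) (fw a u) < e"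
    using cw \<open>e > 0\<close> unfolding continuous_at_eps_delta by blast
  define r where "r = min r0 (min r1 r2)"
  \<comment> \<open>The summand \<open>1\<close> keeps the denominator positive when
    \<open>u\<close> and \<open>w\<close> vanish, and makes the bound on
    \<open>h * (norm u + norm w)\<close> strict.\<close>
  define h where "h = r / (norm u + norm w + 1)"
  have r: "r > 0" "ball a r \<subseteq> S" using r0 r1(1) r2(1) by (auto simp: r_def)
  have pos: "norm u + norm w + 1 > 0" by (smt (verit) norm_ge_zero)
  have h: "h > 0" using r pos by (simp add: h_def)
  have "h * (norm u + norm w + 1) = r" using pos by (simp add: h_def)
  then have hr: "h * (norm u + norm w) < r" "h * (norm w + norm u) < r"
    using h by (simp_all add: algebra_simps)
  obtain p where p: "dist p a < r"
    "f (a + h *\<^sub>R u + h *\<^sub>R w) - f (a + h *\<^sub>R u) - f (a + h *\<^sub>R w) + f a = h * (h * fu p w)"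
    by (rule second_difference_mvt[of a r f f' u fu h w]) (use f fu r h hr in auto)
  obtain q where q: "dist q a < r"
    "f (a + h *\<^sub>R w + h *\<^sub>R u) - f (a + h *\<^sub>R w) - f (a + h *\<^sub>R u) + f a = h * (h * fw q u)"
    by (rule second_difference_mvt[of a r f f' w fw h u]) (use f fw r h hr in auto)
  have "a + h *\<^sub>R w + h *\<^sub>R u = a + h *\<^sub>R u + h *\<^sub>R w" by (simp add: algebra_simps)
  with p(2) q(2) have "h * (h * fu p w) = h * (h * fw q u)"
    by (simp only:)
  then have "fu p w = fw q u" using h by simp
  moreover have "dist (fu p w) (fu a w) < e" "dist (fw q u) (fw a u) < e"
    using r1(2) r2(2) p(1) q(1) by (auto simp: r_def)
  ultimately show False
    using \<open>e > 0\<close> unfolding e_def dist_real_def by (smt (verit) field_sum_of_halves)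
qed

lemma smooth_onD:
  assumes "smooth_on S f" "b \<in> S"
  shows "f differentiable (at b)"
    and "(\<lambda>a. frechet_derivative f (at a) w) differentiable (at b)"
    and "isCont (\<lambda>c. frechet_derivative (\<lambda>a. frechet_derivative f (at a) w) (at c) u) b"
proof -
  have "open S" "Ck_on 2 S f" using assms by (auto simp: smooth_on_def)
  then show "f differentiable (at b)"
    and "(\<lambda>a. frechet_derivative f (at a) w) differentiable (at b)"
    and "isCont (\<lambda>c. frechet_derivative (\<lambda>a. frechet_derivative f (at a) w) (at c) u) b"
    using assms(2)
    by (auto simp: numeral_2_eq_2 differentiable_on_eq_differentiable_at
        continuous_on_eq_continuous_at)
qed

lemma frechet_derivative_nth:
  fixes f :: "'a::euclidean_space \<Rightarrow> real^'m"
  assumes "f differentiable (at b)"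
  shows "((\<lambda>a. f a $ \<sigma>) has_derivative (\<lambda>w. frechet_derivative f (at b) w $ \<sigma>)) (at b)"
    and "frechet_derivative (\<lambda>a. f a $ \<sigma>) (at b) w = frechet_derivative f (at b) w $ \<sigma>"
proof -
  show *: "((\<lambda>a. f a $ \<sigma>) has_derivative (\<lambda>w. frechet_derivative f (at b) w $ \<sigma>)) (at b)"
    using assms frechet_derivative_works
    by (intro bounded_linear.has_derivative[OF bounded_linear_vec_nth]) blast
  show "frechet_derivative (\<lambda>a. f a $ \<sigma>) (at b) w = frechet_derivative f (at b) w $ \<sigma>"
    using frechet_derivative_at[OF *] by metis
qed

text \<open>\<open>frechet_derivative\<close> is a choice among the derivatives at \<open>a\<close>,
  and both functions have the same candidates there. The equality therefore also covers points
  without differentiability.\<close>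

lemma frechet_derivative_cong_open:
  assumes "open S" "a \<in> S" "\<And>b. b \<in> S \<Longrightarrow> f b = g b"
  shows "frechet_derivative f (at a) = frechet_derivative g (at a)"
proof -
  have "(f has_derivative D) (at a) \<longleftrightarrow> (g has_derivative D) (at a)" for D
    using has_derivative_transform_within_open[OF _ assms(1,2)] assms(3) by metis
  then show ?thesis by (simp add: frechet_derivative_def)
qed

lemma smooth_on_mixed_partials:
  fixes f :: "'a::euclidean_space \<Rightarrow> real^'m"
  assumes S: "smooth_on S f" "a \<in> S"
  shows "frechet_derivative (\<lambda>b. frechet_derivative (\<lambda>c. f c $ \<sigma>) (at b) u) (at a) w =
         frechet_derivative (\<lambda>b. frechet_derivative (\<lambda>c. f c $ \<sigma>) (at b) w) (at a) u"
proof -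
  have "open S" using S by (simp add: smooth_on_def)
  have eq: "frechet_derivative (\<lambda>b. frechet_derivative (\<lambda>c. f c $ \<sigma>) (at b) u) (at a) w =
     frechet_derivative (\<lambda>b. frechet_derivative f (at b) u) (at a) w $ \<sigma>" for u w
    using frechet_derivative_cong_open[OF \<open>open S\<close> \<open>a \<in> S\<close>
        frechet_derivative_nth(2)[OF smooth_onD(1)[OF S(1)], of _ \<sigma> u]]
    by (simp add: frechet_derivative_nth(2)[OF smooth_onD(2)[OF S]])
  show ?thesis unfolding eq
    using frechet_derivative_nth(1)[OF smooth_onD(1)[OF S(1)]]
      frechet_derivative_nth(1)[OF smooth_onD(2)[OF S(1)]]
      continuous_component[OF smooth_onD(3)[OF S]]
    by (intro second_derivative_symmetric[OF \<open>open S\<close> \<open>a \<in> S\<close>, where f = "\<lambda>a. f a $ \<sigma>"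
          and f' = "\<lambda>b w. frechet_derivative f (at b) w $ \<sigma>"]) auto
qed

section \<open>Alternating forms and their Lie derivatives\<close>

lemma alt_formD:
  assumes "alt_form m f"
  shows alt_form_cong: "(\<And>i. i < m \<Longrightarrow> \<xi> i = \<xi>' i) \<Longrightarrow> f \<xi> = f \<xi>'"
    and alt_form_linear: "i < m \<Longrightarrow> linear (\<lambda>w. f (\<xi>(i := w)))"
    and alt_form_repeat: "i < m \<Longrightarrow> j < m \<Longrightarrow> i \<noteq> j \<Longrightarrow> \<xi> i = \<xi> j \<Longrightarrow> f \<xi> = 0"
proof -
  note * = assms[unfolded alt_form_def]
  show "f \<xi> = f \<xi>'" if "\<And>i. i < m \<Longrightarrow> \<xi> i = \<xi>' i"
    by (rule conjunct1[OF *, rule_format, OF that])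
  show "linear (\<lambda>w. f (\<xi>(i := w)))" if "i < m"
    by (rule conjunct1[OF conjunct2[OF *], rule_format, OF that])
  show "f \<xi> = 0" if "i < m" "j < m" "i \<noteq> j" "\<xi> i = \<xi> j"
    by (rule conjunct2[OF conjunct2[OF *], rule_format, OF that(1,2) conjI[OF that(3,4)]])
qed

text \<open>Polarisation: with \<open>u + w\<close> in both slots the value is zero, and expanding
  it leaves only the two mixed terms.\<close>

lemma alt_form_swap:
  assumes f: "alt_form m f" and ij: "i < m" "j < m" "i \<noteq> j"
  shows "f (\<xi>(i := u, j := w)) = - f (\<xi>(i := w, j := u))"
proof -
  have twist: "(\<xi>(j := z))(i := x) = \<xi>(i := x, j := z)" for x z
    using ij(3) by (intro fun_upd_twist) simp
  have add_i: "f (\<xi>(i := x + y, j := z)) = f (\<xi>(i := x, j := z)) + f (\<xi>(i := y, j := z))" for x y z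
    using linear_add[OF alt_form_linear[OF f ij(1), of "\<xi>(j := z)"]]
    by (simp only: twist)
  have add_j: "f (\<xi>(i := z, j := x + y)) = f (\<xi>(i := z, j := x)) + f (\<xi>(i := z, j := y))" for x y z
    using linear_add[OF alt_form_linear[OF f ij(2), of "\<xi>(i := z)"]] by simp
  have "f (\<xi>(i := x, j := x)) = 0" for x
    using alt_form_repeat[OF f ij] ij(3) by simp
  from this[of "u + w"] this[of u] this[of w] show ?thesis
    by (simp add: add_i add_j)
qed

text \<open>Moving \<open>b\<close> from slot \<open>0\<close> to slot \<open>i\<close> takes
  \<open>i\<close> transpositions. The resulting sign cancels the one in
  \<open>wedge1\<close>.\<close>

lemma contract_insert:
  assumes f: "alt_form m f" and "i < m"
  shows "contract b f (\<lambda>j. if j < i then \<xi> j else \<xi> (Suc j)) = (- 1) ^ i * f (\<xi>(i := b))"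
  using assms(2)
proof (induction i arbitrary: \<xi>)
  case 0
  show ?case unfolding contract_def
    by (rule arg_cong[of _ _ f, THEN trans]) (auto split: nat.split)
next
  case (Suc i)
  \<comment> \<open>Deleting entry \<open>i\<close> of \<open>\<xi>'\<close> gives the same sequence
    as deleting entry \<open>Suc i\<close> of \<open>\<xi>\<close>, so the induction hypothesis
    applies and a single swap remains.\<close>
  define \<xi>' where "\<xi>' = \<xi>(Suc i := \<xi> i)"
  have "(\<lambda>j. if j < Suc i then \<xi> j else \<xi> (Suc j)) = (\<lambda>j. if j < i then \<xi>' j else \<xi>' (Suc j))"
    by (auto simp: \<xi>'_def fun_eq_iff less_Suc_eq)
  then have "contract b f (\<lambda>j. if j < Suc i then \<xi> j else \<xi> (Suc j))
      = (- 1) ^ i * f (\<xi>'(i := b))"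
    using Suc.IH[of \<xi>'] Suc.prems by (simp only: Suc_lessD)
  also have "\<xi>'(i := b) = \<xi>(i := b, Suc i := \<xi> i)"
    by (auto simp: \<xi>'_def)
  also have "f \<dots> = - f (\<xi>(i := \<xi> i, Suc i := b))"
    using Suc.prems by (intro alt_form_swap[OF f]) auto
  finally show ?case by (simp add: fun_upd_def)
qed

lemma minus_one_power_cancel: "(- 1) ^ i * x * ((- 1) ^ i * y) = x * (y::real)"
  by (cases "even i") auto

text \<open>Insertion acts as a derivation, replacing one argument at a time by its image: the signs
  cancel slot by slot, and linearity reassembles \<open>A (\<xi> i)\<close> from its basis
  components.\<close>

lemma insert_vform_eq_sum:
  fixes A :: "'a::euclidean_space \<Rightarrow> 'a"
  assumes f: "alt_form m f" and "m > 0"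
  shows "insert_vform m A f \<xi> = (\<Sum>i<m. f (\<xi>(i := A (\<xi> i))))"
proof -
  \<comment> \<open>This needs \<open>m > 0\<close>: for \<open>m = 0\<close> truncated subtraction
    would leave the index \<open>0\<close> in the left set.\<close>
  have "{..m - 1} = {..<m}" using \<open>m > 0\<close> by auto
  then have "insert_vform m A f \<xi> = (\<Sum>b\<in>Basis. \<Sum>i<m. (A (\<xi> i) \<bullet> b) * f (\<xi>(i := b)))"
    unfolding insert_vform_def wedge1_def by (simp add: contract_insert[OF f] minus_one_power_cancel)
  also have "\<dots> = (\<Sum>i<m. \<Sum>b\<in>Basis. (A (\<xi> i) \<bullet> b) * f (\<xi>(i := b)))"
    by (rule sum.swap)
  also have "\<dots> = (\<Sum>i<m. f (\<xi>(i := \<Sum>b\<in>Basis. (A (\<xi> i) \<bullet> b) *\<^sub>R b)))"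
  proof (rule sum.cong[OF refl])
    fix i assume "i \<in> {..<m}"
    then interpret linear "\<lambda>w. f (\<xi>(i := w))" using alt_form_linear[OF f] by simp
    show "(\<Sum>b\<in>Basis. (A (\<xi> i) \<bullet> b) * f (\<xi>(i := b)))
        = f (\<xi>(i := \<Sum>b\<in>Basis. (A (\<xi> i) \<bullet> b) *\<^sub>R b))"
      by (simp add: sum scale)
  qed
  finally show ?thesis by (simp add: euclidean_representation)
qed

text \<open>A term that changes a slot other than \<open>i\<close>, \<open>j\<close> still has two
  equal arguments; the terms for \<open>i\<close> and \<open>j\<close> cancel by
  antisymmetry.\<close>

lemma alt_form_derivation_repeat:
  assumes f: "alt_form m f" and ij: "i < m" "j < m" "i \<noteq> j" and eq: "\<xi> i = \<xi> j"
  shows "(\<Sum>k<m. f (\<xi>(k := A (\<xi> k)))) = 0"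
proof -
  have "(\<Sum>k<m. f (\<xi>(k := A (\<xi> k)))) = (\<Sum>k\<in>{i, j}. f (\<xi>(k := A (\<xi> k))))"
  proof (intro sum.mono_neutral_right ballI)
    fix k assume "k \<in> {..<m} - {i, j}"
    then show "f (\<xi>(k := A (\<xi> k))) = 0"
      by (intro alt_form_repeat[OF f ij]) (simp add: eq)
  qed (use ij in auto)
  also have "\<dots> = f (\<xi>(i := A (\<xi> j), j := \<xi> j)) + f (\<xi>(i := \<xi> j, j := A (\<xi> j)))"
    using ij eq by (simp add: fun_upd_idem)
  also have "\<dots> = 0" using alt_form_swap[OF f ij, of \<xi> "A (\<xi> j)" "\<xi> j"] by simp
  finally show ?thesis .
qed

text \<open>\<open>contract\<close> fills only slot \<open>0\<close>; up to sign, an argument in any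
  slot can be moved there.\<close>

lemma alt_form_annihilates:
  assumes f: "alt_form m f" and D: "\<And>w \<xi>. w \<in> D \<Longrightarrow> contract w f \<xi> = 0"
    and "i < m" "\<xi> i \<in> D"
  shows "f \<xi> = 0"
  using contract_insert[OF f \<open>i < m\<close>, of "\<xi> i" \<xi>] D[OF \<open>\<xi> i \<in> D\<close>] by simp

text \<open>Only slotwise linearity is asked of \<open>f\<close> and \<open>g\<close>, so it applies
  to a Lie derivative without first showing that this is alternating.\<close>

lemma slotwise_linear_eqI:
  fixes f g :: "(nat \<Rightarrow> 'a::real_vector) \<Rightarrow> real"
  assumes cong: "\<And>\<xi> \<xi>'. (\<And>i. i < m \<Longrightarrow> \<xi> i = \<xi>' i) \<Longrightarrow> f \<xi> = f \<xi>' \<and> g \<xi> = g \<xi>'"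
    and lin: "\<And>\<xi> i. i < m \<Longrightarrow> linear (\<lambda>w. f (\<xi>(i := w)))" "\<And>\<xi> i. i < m \<Longrightarrow> linear (\<lambda>w. g (\<xi>(i := w)))"
    and span: "span (B \<union> D) = UNIV"
    and D: "\<And>\<xi> i. i < m \<Longrightarrow> \<xi> i \<in> D \<Longrightarrow> f \<xi> = g \<xi>"
    and B: "\<And>\<xi>. (\<And>i. i < m \<Longrightarrow> \<xi> i \<in> B) \<Longrightarrow> f \<xi> = g \<xi>"
  shows "f \<xi> = g \<xi>"
proof -
  \<comment> \<open>\<open>k\<close> counts the leading slots that are still arbitrary; the slots
    from \<open>k\<close> up to \<open>m\<close> already hold vectors of \<open>B\<close>.\<close>
  have "k \<le> m \<Longrightarrow> (\<And>i. k \<le> i \<Longrightarrow> i < m \<Longrightarrow> \<xi> i \<in> B) \<Longrightarrow> f \<xi> = g \<xi>" for k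
  proof (induction k arbitrary: \<xi>)
    case 0
    then show ?case by (intro B) auto
  next
    case (Suc k)
    then have "k < m" by simp
    have "f (\<xi>(k := w)) = g (\<xi>(k := w))" if "w \<in> span (B \<union> D)" for w
    proof (rule linear_eq_on_span[OF lin(1)[OF \<open>k < m\<close>] lin(2)[OF \<open>k < m\<close>] _ that])
      fix w assume "w \<in> B \<union> D"
      then show "f (\<xi>(k := w)) = g (\<xi>(k := w))"
      proof
        assume "w \<in> B"
        then show ?thesis using Suc by (intro Suc.IH) (auto simp: Suc_le_eq)
      next
        assume "w \<in> D"
        then show ?thesis by (intro D[OF \<open>k < m\<close>]) simp
      qed
    qed
    from this[of "\<xi> k"] show ?case by (simp add: span)
  qed
  from this[of m] show ?thesis by simp
qed

section \<open>Lie derivatives of forms, slot by slot\<close>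

lemma lie_bracket_const: "lie_bracket W (\<lambda>b. w) a = - frechet_derivative W (at a) w"
  by (simp add: lie_bracket_def)

lemma lie_form_const:
  "lie_form m W \<Omega> a \<xi> = frechet_derivative (\<lambda>b. \<Omega> b \<xi>) (at a) (W a)
     - (\<Sum>i<m. \<Omega> a (\<xi>(i := - frechet_derivative W (at a) (\<xi> i))))"
  by (simp add: lie_form_def lie_bracket_const)

text \<open>Product rule for a varying form with a varying argument. Differentiability is given only
  for fixed arguments, so \<open>U b\<close> is expanded in \<open>Basis\<close>, which leaves
  products of real functions.\<close>

lemma has_derivative_form_slot:
  fixes \<Omega> :: "'a::euclidean_space \<Rightarrow> (nat \<Rightarrow> 'b::euclidean_space) \<Rightarrow> real"
  assumes "open S" "a \<in> S" "k < m"
    and alt: "\<And>b. b \<in> S \<Longrightarrow> alt_form m (\<Omega> b)"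
    and diff: "\<And>\<xi>. (\<lambda>b. \<Omega> b \<xi>) differentiable (at a)"
    and U: "(U has_derivative U') (at a)"
  shows "((\<lambda>b. \<Omega> b (\<xi>(k := U b))) has_derivative
    (\<lambda>x. \<Omega> a (\<xi>(k := U' x)) + frechet_derivative (\<lambda>b. \<Omega> b (\<xi>(k := U a))) (at a) x)) (at a)"
proof -
  have expand: "\<Omega> b (\<xi>(k := w)) = (\<Sum>B\<in>Basis. (w \<bullet> B) * \<Omega> b (\<xi>(k := B)))" if "b \<in> S" for b w
  proof -
    interpret linear "\<lambda>w. \<Omega> b (\<xi>(k := w))" using alt_form_linear[OF alt[OF that] \<open>k < m\<close>] .
    have "\<Omega> b (\<xi>(k := \<Sum>B\<in>Basis. (w \<bullet> B) *\<^sub>R B)) = (\<Sum>B\<in>Basis. (w \<bullet> B) * \<Omega> b (\<xi>(k := B)))"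
      by (simp add: sum scale)
    then show ?thesis by (simp add: euclidean_representation)
  qed
  let ?d = "\<lambda>w x. frechet_derivative (\<lambda>b. \<Omega> b (\<xi>(k := w))) (at a) x"
  have d: "((\<lambda>b. \<Omega> b (\<xi>(k := w))) has_derivative ?d w) (at a)" for w
    by (rule frechet_derivative_works[THEN iffD1, OF diff])
  \<comment> \<open>By uniqueness of derivatives, the derivative with \<open>w\<close> frozen
    expands over \<open>Basis\<close> just as the form does. This turns the sum below back into a
    derivative with \<open>U a\<close> frozen.\<close>
  have dexp: "?d w x = (\<Sum>B\<in>Basis. (w \<bullet> B) * ?d B x)" for w x
  proof -
    have "((\<lambda>b. \<Sum>B\<in>Basis. (w \<bullet> B) * \<Omega> b (\<xi>(k := B))) has_derivative
        (\<lambda>x. \<Sum>B\<in>Basis. (w \<bullet> B) * ?d B x)) (at a)"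
      by (intro derivative_intros d)
    then have "((\<lambda>b. \<Omega> b (\<xi>(k := w))) has_derivative
        (\<lambda>x. \<Sum>B\<in>Basis. (w \<bullet> B) * ?d B x)) (at a)"
      by (rule has_derivative_transform_within_open[OF _ assms(1,2)]) (rule expand[symmetric])
    then show ?thesis by (rule fun_cong[OF has_derivative_unique[OF d]])
  qed
  have "((\<lambda>b. \<Sum>B\<in>Basis. (U b \<bullet> B) * \<Omega> b (\<xi>(k := B))) has_derivative
      (\<lambda>x. \<Sum>B\<in>Basis. (U a \<bullet> B) * ?d B x + (U' x \<bullet> B) * \<Omega> a (\<xi>(k := B)))) (at a)"
    by (intro has_derivative_sum has_derivative_mult d has_derivative_inner_left U)
  moreover have "(\<Sum>B\<in>Basis. (U a \<bullet> B) * ?d B x + (U' x \<bullet> B) * \<Omega> a (\<xi>(k := B)))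
      = \<Omega> a (\<xi>(k := U' x)) + ?d (U a) x" for x
    by (simp add: dexp[of "U a"] expand[OF \<open>a \<in> S\<close>, of "U' x"] sum.distrib)
  ultimately have "((\<lambda>b. \<Sum>B\<in>Basis. (U b \<bullet> B) * \<Omega> b (\<xi>(k := B))) has_derivative
      (\<lambda>x. \<Omega> a (\<xi>(k := U' x)) + ?d (U a) x)) (at a)" by simp
  then show ?thesis
    by (rule has_derivative_transform_within_open[OF _ assms(1,2)]) (rule expand[symmetric])
qed

text \<open>Linearity of the forms near \<open>a\<close> passes to the derivative term by uniqueness
  of derivatives. In the bracket terms, the varied slot either is the one being bracketed or stays
  untouched.\<close>

lemma linear_lie_form_slot:
  fixes \<Omega> :: "'a::euclidean_space \<Rightarrow> (nat \<Rightarrow> 'a) \<Rightarrow> real"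
  assumes S: "open S" "a \<in> S" and k: "k < m"
    and alt: "\<And>b. b \<in> S \<Longrightarrow> alt_form m (\<Omega> b)"
    and diff: "\<And>\<xi>. (\<lambda>b. \<Omega> b \<xi>) differentiable (at a)"
    and W: "W differentiable (at a)"
  shows "linear (\<lambda>w. lie_form m W \<Omega> a (\<xi>(k := w)))"
proof -
  let ?d = "\<lambda>w. frechet_derivative (\<lambda>b. \<Omega> b (\<xi>(k := w))) (at a)"
  have d: "((\<lambda>b. \<Omega> b (\<xi>(k := w))) has_derivative ?d w) (at a)" for w
    by (rule frechet_derivative_works[THEN iffD1, OF diff])
  have lin: "linear (\<lambda>w. \<Omega> b (\<xi>(k := w)))" if "b \<in> S" for b \<xi>
    using alt_form_linear[OF alt[OF that] k] .
  have "linear (\<lambda>w. ?d w (W a))"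
  proof (rule linearI)
    fix u w
    have "((\<lambda>b. \<Omega> b (\<xi>(k := u + w))) has_derivative (\<lambda>x. ?d u x + ?d w x)) (at a)"
      by (rule has_derivative_transform_within_open[OF has_derivative_add[OF d[of u] d[of w]] S])
        (simp add: linear_add[OF lin])
    then show "?d (u + w) (W a) = ?d u (W a) + ?d w (W a)"
      by (rule fun_cong[OF has_derivative_unique[OF d]])
  next
    fix r u
    have "((\<lambda>b. \<Omega> b (\<xi>(k := r *\<^sub>R u))) has_derivative (\<lambda>x. r *\<^sub>R ?d u x)) (at a)"
      by (rule has_derivative_transform_within_open[OF has_derivative_scaleR_right[OF d[of u]] S])
        (simp add: linear_scale[OF lin])
    then show "?d (r *\<^sub>R u) (W a) = r *\<^sub>R ?d u (W a)"
      by (rule fun_cong[OF has_derivative_unique[OF d]])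
  qed
  moreover have "linear (\<lambda>w. \<Omega> a ((\<xi>(k := w))(i := - frechet_derivative W (at a) ((\<xi>(k := w)) i))))"
    for i
  proof (cases "i = k")
    case True
    have "linear (\<lambda>w. - frechet_derivative W (at a) w)"
      using W by (intro linear_compose_neg linear_frechet_derivative)
    from linear_compose[OF this lin[OF \<open>a \<in> S\<close>]] show ?thesis
      using True by (simp add: o_def)
  next
    case False
    then have "(\<xi>(k := w))(i := c) = (\<xi>(i := c))(k := w)" for w c
      by (intro fun_upd_twist) simp
    then show ?thesis using False lin[OF \<open>a \<in> S\<close>] by simp
  qed
  ultimately show ?thesis
    unfolding lie_form_const by (intro linear_compose_sub linear_compose_sum ballI)
qed

text \<open>If \<open>U\<close> is a section of the annihilator of \<open>\<Omega>\<close>, differentiating \<open>\<Omega>(\<dots>, U, \<dots>) = 0\<close> along \<open>W\<close>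
  leaves \<open>\<Omega>(\<dots>, [W, U], \<dots>)\<close>.\<close>

lemma lie_form_annihilates:
  fixes \<Omega> :: "'a::euclidean_space \<Rightarrow> (nat \<Rightarrow> 'a) \<Rightarrow> real"
  assumes S: "open S" "a \<in> S" and k: "k < m"
    and alt: "\<And>b. b \<in> S \<Longrightarrow> alt_form m (\<Omega> b)"
    and diff: "\<And>\<xi>. (\<lambda>b. \<Omega> b \<xi>) differentiable (at a)"
    and D: "\<And>b w \<xi>. b \<in> S \<Longrightarrow> w \<in> D b \<Longrightarrow> contract w (\<Omega> b) \<xi> = 0"
    and U: "U differentiable (at a)" "\<And>b. b \<in> S \<Longrightarrow> U b \<in> D b" "U a = \<xi> k"
    and bracket: "lie_bracket W U a \<in> D a"
  shows "lie_form m W \<Omega> a \<xi> = 0"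
proof -
  let ?U' = "frechet_derivative U (at a)" and ?W' = "frechet_derivative W (at a)"
  have zero: "\<Omega> b \<eta> = 0" if "b \<in> S" "i < m" "\<eta> i \<in> D b" for b \<eta> i
    by (rule alt_form_annihilates[where D = "D b" and \<xi> = \<eta>, OF alt[OF that(1)] _ that(2,3)])
      (rule D[OF that(1)])
  have Ua: "\<xi>(k := U a) = \<xi>" using U(3) by simp
  have "(U has_derivative ?U') (at a)" using U(1) frechet_derivative_works by blast
  from has_derivative_form_slot[where \<Omega> = \<Omega> and \<xi> = \<xi>, OF S k alt diff this]
  have "((\<lambda>b. \<Omega> b (\<xi>(k := U b))) has_derivative
    (\<lambda>x. \<Omega> a (\<xi>(k := ?U' x)) + frechet_derivative (\<lambda>b. \<Omega> b \<xi>) (at a) x)) (at a)"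
    by (simp add: Ua)
  \<comment> \<open>The function is identically zero on \<open>S\<close>, so the two terms of the
    product rule add up to zero.\<close>
  moreover have "((\<lambda>b. \<Omega> b (\<xi>(k := U b))) has_derivative (\<lambda>x. 0)) (at a)"
    by (rule has_derivative_transform_within_open[OF has_derivative_const S])
      (rule sym, rule zero[OF _ k], simp_all add: U(2))
  ultimately have 1: "\<Omega> a (\<xi>(k := ?U' x)) + frechet_derivative (\<lambda>b. \<Omega> b \<xi>) (at a) x = 0" for x
    by (rule fun_cong[OF has_derivative_unique])
  \<comment> \<open>For \<open>i\<close> different from \<open>k\<close>, slot \<open>k\<close>
    still holds \<open>U a\<close>, which lies in \<open>D a\<close>.\<close>
  have "(\<Sum>i<m. \<Omega> a (\<xi>(i := - ?W' (\<xi> i)))) = (\<Sum>i\<in>{k}. \<Omega> a (\<xi>(i := - ?W' (\<xi> i))))"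
    using k U(2)[OF \<open>a \<in> S\<close>] U(3)
    by (intro sum.mono_neutral_right) (auto intro!: zero[OF \<open>a \<in> S\<close> k] split: if_splits)
  also have "\<dots> = \<Omega> a (\<xi>(k := - ?W' (\<xi> k)))" by simp
  finally have "lie_form m W \<Omega> a \<xi> = - (\<Omega> a (\<xi>(k := ?U' (W a))) + \<Omega> a (\<xi>(k := - ?W' (\<xi> k))))"
    using 1[of "W a"] by (simp add: lie_form_const)
  also have "\<dots> = - \<Omega> a (\<xi>(k := ?U' (W a) + - ?W' (\<xi> k)))"
    using linear_add[OF alt_form_linear[of m "\<Omega> a" k \<xi>, OF alt[OF \<open>a \<in> S\<close>] k],
        of "?U' (W a)" "- ?W' (\<xi> k)"] by simp
  also have "\<dots> = 0"
    using zero[OF \<open>a \<in> S\<close> k, of "\<xi>(k := lie_bracket W U a)"] bracket U(3)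
    by (simp add: lie_bracket_def)
  finally show ?thesis .
qed

lemma lie_form_cong:
  assumes S: "open S" "a \<in> S" and alt: "\<And>b. b \<in> S \<Longrightarrow> alt_form m (\<Omega> b)"
    and eq: "\<And>i. i < m \<Longrightarrow> \<xi> i = \<xi>' i"
  shows "lie_form m W \<Omega> a \<xi> = lie_form m W \<Omega> a \<xi>'"
proof -
  have "frechet_derivative (\<lambda>b. \<Omega> b \<xi>) (at a) = frechet_derivative (\<lambda>b. \<Omega> b \<xi>') (at a)"
    by (rule frechet_derivative_cong_open[OF S alt_form_cong[OF alt eq]])
  moreover have "\<Omega> a (\<xi>(i := - frechet_derivative W (at a) (\<xi> i)))
      = \<Omega> a (\<xi>'(i := - frechet_derivative W (at a) (\<xi>' i)))" if "i < m" for i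
    using that by (intro alt_form_cong[OF alt[OF \<open>a \<in> S\<close>]]) (simp add: eq)
  ultimately show ?thesis by (simp add: lie_form_const)
qed

section \<open>Jets and connection components\<close>

lemma jet2_in_snd: "local_section M x \<gamma> \<Longrightarrow> \<gamma> \<in> snd (jet2 M x \<gamma>)"
  by (simp add: jet2_def)

lemma pi10_jet1: "local_section M x \<gamma> \<Longrightarrow> pi10 (jet1 M x \<gamma>) = \<gamma> x"
proof -
  assume "local_section M x \<gamma>"
  then have "(\<lambda>\<delta>. \<delta> x) ` snd (jet1 M x \<gamma>) = {\<gamma> x}"
    by (force simp: jet1_def)
  then show ?thesis by (simp add: pi10_def) (simp add: jet1_def)
qed

text \<open>Second order contact implies first order contact, so all representatives of the 2-jet
  yield the same 1-jet.\<close>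

lemma pi21_jet2: "local_section M x \<gamma> \<Longrightarrow> pi21 M (jet2 M x \<gamma>) = jet1 M x \<gamma>"
proof -
  assume ls: "local_section M x \<gamma>"
  have "jet1 M x \<delta> = jet1 M x \<gamma>" if "\<delta> \<in> snd (jet2 M x \<gamma>)" for \<delta>
    using that by (auto simp: jet1_def jet2_def)
  then have "jet1 M x ` snd (jet2 M x \<gamma>) = {jet1 M x \<gamma>}"
    using jet2_in_snd[OF ls] by blast
  moreover have "fst (jet2 M x \<gamma>) = x" by (simp add: jet2_def)
  ultimately show ?thesis by (simp add: pi21_def)
qed

lemma y2_jet2:
  assumes "local_section M x \<gamma>" "c \<in> charts M" "\<gamma> x \<in> cdom c"
  shows "y2 M c (jet2 M x \<gamma>) = d2 M c x \<gamma>"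
proof -
  have "d2 M c x \<delta> = d2 M c x \<gamma>" if "\<delta> \<in> snd (jet2 M x \<gamma>)" for \<delta>
    using that assms by (auto simp: jet2_def)
  then have "d2 M c x ` snd (jet2 M x \<gamma>) = {d2 M c x \<gamma>}"
    using jet2_in_snd[OF assms(1)] by blast
  moreover have "fst (jet2 M x \<gamma>) = x" by (simp add: jet2_def)
  ultimately show ?thesis by (simp add: y2_def)
qed

lemma d2_symmetric:
  assumes "local_section M x \<gamma>" "c \<in> charts M" "\<gamma> x \<in> cdom c"
  shows "d2 M c x \<gamma> $ \<sigma> $ i $ j = d2 M c x \<gamma> $ \<sigma> $ j $ i"
proof -
  obtain U where "x \<in> U" "smooth_on (xc c ` U) (sec_rep M c \<gamma>)"
    using assms unfolding local_section_def by blast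
  then show ?thesis
    by (simp add: d2_def smooth_on_mixed_partials[of "xc c ` U" "sec_rep M c \<gamma>" "xc c x" \<sigma> "axis i 1"])
qed

text \<open>The components are second derivatives of a section representing the 2-jet, so the
  symmetry is that of mixed partials. The section property of \<open>\<Gamma>\<close> places that
  section in the chart domain.\<close>

lemma conn_comp_symmetric:
  assumes "second_order_connection M \<Gamma>" "c \<in> charts M" "p \<in> jdom M c"
  shows "conn_comp M \<Gamma> c (jc M c p) $ \<sigma> $ i $ j = conn_comp M \<Gamma> c (jc M c p) $ \<sigma> $ j $ i"
proof -
  define p' where "p' = jinv M c (jc M c p)"
  have p': "p' \<in> jdom M c"
    unfolding p'_def jinv_def using assms(3) by (intro inv_into_into) simp
  then have "\<Gamma> p' \<in> J2 M" "pi21 M (\<Gamma> p') = p'"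
    using assms(1) by (auto simp: second_order_connection_def jdom_def)
  then obtain x \<gamma> where ls: "local_section M x \<gamma>" and \<Gamma>: "\<Gamma> p' = jet2 M x \<gamma>"
    and "p' = jet1 M x \<gamma>"
    by (auto simp: J2_def pi21_jet2)
  then have "\<gamma> x \<in> cdom c" using p' by (simp add: jdom_def pi10_jet1)
  then show ?thesis
    using y2_jet2[OF ls assms(2)] d2_symmetric[OF ls assms(2)]
    by (simp add: conn_comp_def \<Gamma> flip: p'_def)
qed

section \<open>From chart coordinates of the total space to jets\<close>

lemma totinv_totc:
  assumes "fibred_manifold M" "c \<in> charts M" "y \<in> cdom c"
  shows "totinv M c (totc M c y) = y"
proof -
  have "openin (tot M) (cdom c)"
    and "homeomorphic_map (subtopology (tot M) (cdom c)) (top_of_set (totc M c ` cdom c)) (totc M c)"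
    using assms(1,2) by (auto simp: fibred_manifold_def)
  then have "inj_on (totc M c) (cdom c)"
    using homeomorphic_imp_injective_map[of "subtopology (tot M) (cdom c)"] openin_subset
    by (fastforce simp: Int_absorb1)
  then show ?thesis by (simp add: totinv_def assms(3))
qed

lemma fst_eq_proj_pi10:
  assumes M: "fibred_manifold M" and "p \<in> J1 M"
  shows "fst p = proj M (pi10 p)"
proof -
  obtain x \<gamma> where ls: "local_section M x \<gamma>" and p: "p = jet1 M x \<gamma>"
    using \<open>p \<in> J1 M\<close> by (auto simp: J1_def)
  have "\<gamma> x \<in> \<Union> (cdom ` charts M)"
    using ls M by (simp add: local_section_def fibred_manifold_def)
  then obtain c where "c \<in> charts M" "\<gamma> x \<in> cdom c" by blast
  then have "proj M (\<gamma> x) = x" using ls unfolding local_section_def by blast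
  then show ?thesis unfolding p using ls by (simp add: pi10_jet1) (simp add: jet1_def)
qed

text \<open>The symmetry of \<open>conn_comp\<close> is available at coordinates of jets; this
  provides it along the image of \<open>Z\<close>.\<close>

lemma Z_lift_eq_jc:
  assumes M: "fibred_manifold M" and Z: "local_connection M V Z" and c: "c \<in> charts M"
    and y: "y \<in> V \<inter> cdom c"
  shows "Z_lift (loc_comp M Z c) (totc M c y) = jc M c (Z y)" and "Z y \<in> jdom M c"
proof -
  have "Z y \<in> J1 M" "pi10 (Z y) = y" using Z y by (auto simp: local_connection_def)
  then show "Z y \<in> jdom M c" using y by (simp add: jdom_def)
  have "fst (Z y) = proj M y"
    using fst_eq_proj_pi10[OF M \<open>Z y \<in> J1 M\<close>] \<open>pi10 (Z y) = y\<close> by simp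
  then show "Z_lift (loc_comp M Z c) (totc M c y) = jc M c (Z y)"
    using totinv_totc[OF M c] y \<open>pi10 (Z y) = y\<close>
    by (simp add: Z_lift_def jc_def totc_def[of M c y] loc_comp_def) (simp add: totc_def)
qed

section \<open>The distribution of an embedded connection\<close>

text \<open>The base components of \<open>d\<close> are its coefficients along the vectors
  \<open>Gam F i q\<close>, hence determine the jet components.\<close>

lemma D_Gam_expand:
  assumes "d \<in> D_Gam F q"
  shows "snd (snd d) $ \<sigma> $ j = (\<Sum>i\<in>UNIV. fst d $ i * F q $ \<sigma> $ i $ j)"
proof -
  have g: "(\<Sum>i\<in>UNIV. fst (Gam F k q) $ i * F q $ \<sigma> $ i $ j) = F q $ \<sigma> $ k $ j" for k
  proof -
    have "fst (Gam F k q) $ i * F q $ \<sigma> $ i $ j = (if k = i then F q $ \<sigma> $ i $ j else 0)" for i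
      by (simp add: Gam_def axis_def)
    then show ?thesis by simp
  qed
  from assms show ?thesis unfolding D_Gam_def
  proof (induction rule: span_induct_alt)
    case (step r w d)
    then obtain k where w: "w = Gam F k q" by auto
    have "snd (snd w) $ \<sigma> $ j = F q $ \<sigma> $ k $ j" by (simp add: w Gam_def)
    then show ?case
      using step(2) by (simp add: distrib_right sum.distrib mult.assoc w g flip: sum_distrib_left)
  qed simp
qed

text \<open>The distribution is the graph of the linear map \<open>\<zeta> a\<close>, which replaces
  span arguments by one equation.\<close>

lemma D_Z_iff: "w \<in> D_Z \<zeta> a \<longleftrightarrow> snd w = \<zeta> a *v fst w"
proof
  have *: "Z_vec \<zeta> i a = (axis i 1, \<zeta> a *v axis i 1)" for i
    by (simp add: Z_vec_def vec_eq_iff matrix_vector_mult_basis column_def)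
  show "snd w = \<zeta> a *v fst w" if "w \<in> D_Z \<zeta> a"
    using that unfolding D_Z_def
    by (induction rule: span_induct_alt)
      (auto simp: * matrix_vector_right_distrib matrix_vector_mult_scaleR)
  assume w: "snd w = \<zeta> a *v fst w"
  have e: "fst w = (\<Sum>i\<in>UNIV. fst w $ i *\<^sub>R axis i 1)"
    using basis_expansion[of "fst w"] by (simp add: scalar_mult_eq_scaleR)
  then have "snd w = (\<Sum>i\<in>UNIV. fst w $ i *\<^sub>R (\<zeta> a *v axis i 1))"
    unfolding w by (metis (no_types, lifting) linear_sum matrix_vector_mul_linear
        matrix_vector_mult_scaleR sum.cong)
  with e have "w = (\<Sum>i\<in>UNIV. fst w $ i *\<^sub>R Z_vec \<zeta> i a)"
    by (simp add: * prod_eq_iff fst_sum snd_sum)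
  also have "\<dots> \<in> D_Z \<zeta> a"
    unfolding D_Z_def by (intro span_sum span_scale span_base) auto
  finally show "w \<in> D_Z \<zeta> a" .
qed

lemma Z_v_eq: "Z_v \<zeta> v a = (v (fst a), \<zeta> a *v v (fst a))"
proof -
  have "fst (Z_v \<zeta> v a) = v (fst a)"
    using basis_expansion[of "v (fst a)"]
    by (simp add: Z_v_def Z_vec_def fst_sum scalar_mult_eq_scaleR)
  moreover have "Z_v \<zeta> v a \<in> D_Z \<zeta> a"
    unfolding Z_v_def D_Z_def by (intro span_sum span_scale span_base) auto
  ultimately show ?thesis by (simp add: D_Z_iff prod_eq_iff)
qed

lemma bounded_bilinear_matrix_vector_mult:
  "bounded_bilinear ((*v) :: real^'n^'m \<Rightarrow> real^'n \<Rightarrow> real^'m)"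
  unfolding bilinear_conv_bounded_bilinear[symmetric] bilinear_def
  by (auto intro!: linearI simp: matrix_vector_mult_add_rdistrib matrix_vector_right_distrib
      matrix_vector_mult_scaleR scaleR_matrix_vector_assoc)

text \<open>Embeddedness says \<open>d\<zeta>\<^sup>\<sigma>\<^sub>j(Z\<^sub>i) = F\<^sup>\<sigma>\<^sub>i\<^sub>j\<close>, so the bracket is in \<open>D\<^sub>Z\<close> because \<open>F\<close> is symmetric.\<close>

lemma lie_bracket_Z_v_mem_D_Z:
  fixes \<zeta> :: "('n::finite,'m::finite) ycoord \<Rightarrow> real^'n^'m"
  assumes \<zeta>: "\<zeta> differentiable (at a)" and v: "v differentiable (at (fst a))"
    and emb: "frechet_derivative (Z_lift \<zeta>) (at a) ` D_Z \<zeta> a \<subseteq> D_Gam F (Z_lift \<zeta> a)"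
    and sym: "\<And>\<sigma> i j. F (Z_lift \<zeta> a) $ \<sigma> $ i $ j = F (Z_lift \<zeta> a) $ \<sigma> $ j $ i"
  shows "lie_bracket (Z_v \<zeta> v) (\<lambda>b. (c, \<zeta> b *v c)) a \<in> D_Z \<zeta> a"
    and "Z_v \<zeta> v differentiable (at a)" "(\<lambda>b. (c, \<zeta> b *v c)) differentiable (at a)"
proof -
  let ?d = "frechet_derivative \<zeta> (at a)" and ?V = "v (fst a)"
    and ?dv = "frechet_derivative v (at (fst a))"
  note bb = bounded_bilinear.FDERIV[OF bounded_bilinear_matrix_vector_mult]
  have d: "(\<zeta> has_derivative ?d) (at a)" using \<zeta> by (simp add: frechet_derivative_works)
  have dv: "((\<lambda>b. v (fst b)) has_derivative (\<lambda>x. ?dv (fst x))) (at a)"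
    by (rule has_derivative_compose[where f = fst and g = v])
      (use v in \<open>auto intro: derivative_intros simp: frechet_derivative_works\<close>)
  have "(Z_lift \<zeta> has_derivative (\<lambda>x. (fst x, snd x, ?d x))) (at a)"
    unfolding Z_lift_def[abs_def] by (intro derivative_intros d)
  then have lift: "frechet_derivative (Z_lift \<zeta>) (at a) = (\<lambda>x. (fst x, snd x, ?d x))"
    by (rule frechet_derivative_at[symmetric])
  have dF: "?d (x, \<zeta> a *v x) $ \<sigma> $ j = (\<Sum>i\<in>UNIV. x $ i * F (Z_lift \<zeta> a) $ \<sigma> $ i $ j)" for x \<sigma> j
  proof -
    have "(x, \<zeta> a *v x) \<in> D_Z \<zeta> a" by (simp add: D_Z_iff)
    with emb have "(x, \<zeta> a *v x, ?d (x, \<zeta> a *v x)) \<in> D_Gam F (Z_lift \<zeta> a)"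
      unfolding lift by force
    from D_Gam_expand[OF this] show ?thesis by simp
  qed
  \<comment> \<open>Both sides contract \<open>F\<close> with \<open>?V\<close> and
    \<open>c\<close>, in opposite orders of the lower indices.\<close>
  have comm: "?d (?V, \<zeta> a *v ?V) *v c = ?d (c, \<zeta> a *v c) *v ?V"
  proof -
    have "(\<Sum>j\<in>UNIV. (\<Sum>i\<in>UNIV. ?V $ i * F (Z_lift \<zeta> a) $ \<sigma> $ i $ j) * c $ j)
        = (\<Sum>j\<in>UNIV. (\<Sum>i\<in>UNIV. c $ i * F (Z_lift \<zeta> a) $ \<sigma> $ i $ j) * ?V $ j)" for \<sigma>
      unfolding sum_distrib_right
      by (subst sum.swap) (simp add: sym[of \<sigma>] mult_ac)
    moreover have "(A *v x) $ \<sigma> = (\<Sum>j\<in>UNIV. A $ \<sigma> $ j * x $ j)" for A :: "real^'n^'m" and x \<sigma>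
      by (simp add: matrix_vector_mult_def)
    ultimately show ?thesis by (simp add: vec_eq_iff dF)
  qed
  have U: "((\<lambda>b. (c, \<zeta> b *v c)) has_derivative (\<lambda>x. (0, ?d x *v c))) (at a)"
    using bb[OF d has_derivative_const[of c]]
    by (intro has_derivative_Pair has_derivative_const) simp
  then show "(\<lambda>b. (c, \<zeta> b *v c)) differentiable (at a)"
    by (rule differentiableI)
  have W: "(Z_v \<zeta> v has_derivative (\<lambda>x. (?dv (fst x), \<zeta> a *v ?dv (fst x) + ?d x *v ?V))) (at a)"
    unfolding Z_v_eq[abs_def] by (intro has_derivative_Pair dv bb[OF d dv])
  then show "Z_v \<zeta> v differentiable (at a)"
    by (rule differentiableI)
  \<comment> \<open>The two terms compared in \<open>comm\<close> cancel. What remains is the lift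
    to \<open>D_Z\<close> of minus the derivative of \<open>v\<close> along
    \<open>c\<close>.\<close>
  show "lie_bracket (Z_v \<zeta> v) (\<lambda>b. (c, \<zeta> b *v c)) a \<in> D_Z \<zeta> a"
    unfolding lie_bracket_def frechet_derivative_at[OF U, symmetric]
      frechet_derivative_at[OF W, symmetric]
    by (simp add: D_Z_iff Z_v_eq comm matrix_vector_mult_diff_distrib
        linear_neg[OF matrix_vector_mul_linear])
qed

section \<open>The trace on vertical frames\<close>

lemma vertical_expand:
  fixes w :: "('n::finite,'m::finite) ycoord"
  assumes "fst w = 0"
  shows "w = (\<Sum>\<sigma>\<in>UNIV. snd w $ \<sigma> *\<^sub>R (0, axis \<sigma> 1))"
  using assms basis_expansion[of "snd w"]
  by (simp add: prod_eq_iff fst_sum snd_sum scalar_mult_eq_scaleR)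

text \<open>If a frame vector is repeated, both sides vanish. Otherwise each vertical basis vector
  occurs exactly once, and slot \<open>i\<close> contributes the diagonal component with index
  \<open>g i\<close>.\<close>

lemma insert_vform_vertical_frame:
  fixes A :: "('n::finite,'m::finite) ycoord \<Rightarrow> ('n,'m) ycoord"
  assumes f: "alt_form CARD('m) f" and A: "\<And>w. fst (A w) = 0"
    and \<xi>: "\<And>i. i < CARD('m) \<Longrightarrow> \<xi> i \<in> range (\<lambda>\<sigma>. (0, axis \<sigma> 1))"
  shows "insert_vform CARD('m) A f \<xi> = vform_trace A * f \<xi>"
proof -
  let ?m = "CARD('m)" and ?e = "\<lambda>\<sigma>::'m. (0 :: real^'n, axis \<sigma> (1::real))"
  obtain g where g: "\<And>i. i < ?m \<Longrightarrow> \<xi> i = ?e (g i)"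
  proof -
    have "\<forall>i. \<exists>\<sigma>. i < ?m \<longrightarrow> \<xi> i = ?e \<sigma>" using \<xi> by blast
    then show thesis using that by metis
  qed
  have sum: "insert_vform ?m A f \<xi> = (\<Sum>i<?m. f (\<xi>(i := A (\<xi> i))))"
    by (rule insert_vform_eq_sum[OF f]) simp
  show ?thesis
  proof (cases "inj_on g {..<?m}")
    case False
    then obtain i j where ij: "i < ?m" "j < ?m" "i \<noteq> j" "g i = g j"
      by (auto simp: inj_on_def)
    then have "\<xi> i = \<xi> j" by (simp add: g)
    then show ?thesis
      using alt_form_derivation_repeat[OF f ij(1-3), of \<xi> A] alt_form_repeat[OF f ij(1-3), of \<xi>] sum
      by simp
  next
    case True
    then have "card (g ` {..<?m}) = CARD('m)" by (simp add: card_image)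
    then have surj: "g ` {..<?m} = UNIV" by (intro card_subset_eq) auto
    have "f (\<xi>(i := A (\<xi> i))) = vform_comp A (g i) (g i) * f \<xi>" if i: "i < ?m" for i
    proof -
      define h where "h w = f (\<xi>(i := w))" for w
      have h: "linear h" unfolding h_def by (rule alt_form_linear[OF f i])
      \<comment> \<open>Surjectivity of \<open>g\<close> puts every other basis vector into another
        slot, where it repeats.\<close>
      have zero: "h (?e \<sigma>) = 0" if "\<sigma> \<noteq> g i" for \<sigma>
      proof -
        obtain j where "j < ?m" "\<sigma> = g j" using surj by force
        then show ?thesis
          using that i unfolding h_def by (intro alt_form_repeat[OF f i, of j]) (auto simp: g)
      qed
      have "h (A (\<xi> i)) = (\<Sum>\<sigma>\<in>UNIV. snd (A (\<xi> i)) $ \<sigma> * h (?e \<sigma>))"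
        by (subst vertical_expand[OF A]) (simp only: linear_sum[OF h] linear_scale[OF h] real_scaleR_def)
      also have "\<dots> = (\<Sum>\<sigma>\<in>{g i}. snd (A (\<xi> i)) $ \<sigma> * h (?e \<sigma>))"
        by (intro sum.mono_neutral_right) (simp_all add: zero)
      also have "\<dots> = vform_comp A (g i) (g i) * h (\<xi> i)"
        by (simp add: vform_comp_def g[OF i])
      finally show ?thesis by (simp add: h_def)
    qed
    then have "insert_vform ?m A f \<xi> = (\<Sum>i<?m. vform_comp A (g i) (g i)) * f \<xi>"
      by (simp add: sum sum_distrib_right)
    also have "(\<Sum>i<?m. vform_comp A (g i) (g i)) = vform_trace A"
      using sum.reindex[OF True, of "\<lambda>\<sigma>. vform_comp A \<sigma> \<sigma>"]
      by (simp add: surj vform_trace_def)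
    finally show ?thesis .
  qed
qed

text \<open>Subtracting from \<open>w\<close> the lift of its base part to \<open>D_Z\<close> leaves
  a vertical vector.\<close>

lemma span_vertical_D_Z:
  fixes \<zeta> :: "('n::finite,'m::finite) ycoord \<Rightarrow> real^'n^'m"
  shows "span (range (\<lambda>\<sigma>. (0, axis \<sigma> 1)) \<union> D_Z \<zeta> a) = UNIV"
proof -
  let ?B = "range (\<lambda>\<sigma>::'m. (0 :: real^'n, axis \<sigma> (1::real)))"
  have "w \<in> span (?B \<union> D_Z \<zeta> a)" for w
  proof -
    define u where "u = (fst w, \<zeta> a *v fst w)"
    have "u \<in> span (?B \<union> D_Z \<zeta> a)" by (intro span_base UnI2) (simp add: D_Z_iff u_def)
    moreover have "w - u \<in> span (?B \<union> D_Z \<zeta> a)"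
    proof -
      have "fst (w - u) = 0" by (simp add: u_def)
      then show ?thesis
        by (subst vertical_expand[of "w - u"]) (assumption, intro span_sum span_scale span_base UnI1 rangeI)
    qed
    ultimately have "u + (w - u) \<in> span (?B \<union> D_Z \<zeta> a)" by (rule span_add)
    then show ?thesis by simp
  qed
  then show ?thesis by auto
qed

lemma characterising_formD:
  assumes \<Omega>: "characterising_form M V Z (\<Omega> :: ('x, 'y, 'n::finite, 'm::finite) fchart \<Rightarrow> _)"
    and c: "c \<in> charts M"
  shows characterising_form_alt:
      "b \<in> totc M c ` (V \<inter> cdom c) \<Longrightarrow> alt_form CARD('m) (\<Omega> c b)"
    and characterising_form_smooth:
      "smooth_on (totc M c ` (V \<inter> cdom c)) (\<lambda>b. \<Omega> c b \<xi>)"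
    and characterising_form_contract:
      "b \<in> totc M c ` (V \<inter> cdom c) \<Longrightarrow> w \<in> D_Z (loc_comp M Z c) b \<Longrightarrow> contract w (\<Omega> c b) \<xi> = 0"
proof -
  note * = \<Omega>[unfolded characterising_form_def m_form_def]
  note form = bspec[OF conjunct1[OF conjunct1[OF *]] c]
  show "alt_form CARD('m) (\<Omega> c b)" if "b \<in> totc M c ` (V \<inter> cdom c)"
    by (rule bspec[OF conjunct1[OF form] that])
  show "smooth_on (totc M c ` (V \<inter> cdom c)) (\<lambda>b. \<Omega> c b \<xi>)"
    by (rule spec[OF conjunct2[OF form]])
  show "contract w (\<Omega> c b) \<xi> = 0"
    if "b \<in> totc M c ` (V \<inter> cdom c)" "w \<in> D_Z (loc_comp M Z c) b"
    by (rule spec[OF bspec[OF conjunct2[OF bspec[OF bspec[OF conjunct2[OF *] c] that(1)]] that(2)]])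
qed

theorem theorem3p3p5:
  fixes M :: "('x, 'y, 'n::finite, 'm::finite) fibred_space"
    and \<Gamma> :: "('x, 'y) jet \<Rightarrow> ('x, 'y) jet"
    and \<phi> v :: "('x, 'y, 'n, 'm) fchart \<Rightarrow> real^'n \<Rightarrow> real^'n"
    and V :: "'y set"
    and Z :: "'y \<Rightarrow> ('x, 'y) jet"
    and \<Omega> :: "('x, 'y, 'n, 'm) fchart \<Rightarrow> ('n, 'm) ycoord \<Rightarrow> (nat \<Rightarrow> ('n, 'm) ycoord) \<Rightarrow> real"
  assumes "CARD('n) > 1"
    and "fibred_manifold M"
    and "second_order_connection M \<Gamma>"
    and "base_one_form M \<phi>" and "closed_form M \<phi>" and "nonvanishing_form M \<phi>"
    and "base_vector_field M v"
    and "\<forall>c\<in>charts M. \<forall>a \<in> xc c ` bdom M c. v c a \<bullet> \<phi> c a = 1"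
    and "local_connection M V Z"
    and "embedded_in M \<Gamma> V Z"
    and "compatible_volume M \<Gamma> \<phi> v V Z \<Omega>"
  shows "\<forall>c\<in>charts M. \<forall>a \<in> totc M c ` (V \<inter> cdom c). \<forall>\<xi>.
    lie_Zv M v Z \<Omega> c a \<xi> = vform_trace (A_Z M \<Gamma> \<phi> v Z c a) * \<Omega> c a \<xi>"
proof (intro ballI allI)
  fix c a and \<xi> :: "nat \<Rightarrow> ('n, 'm) ycoord"
  assume c: "c \<in> charts M" and a: "a \<in> totc M c ` (V \<inter> cdom c)"
  let ?S = "totc M c ` (V \<inter> cdom c)" and ?\<zeta> = "loc_comp M Z c" and ?m = "CARD('m)"
  let ?A = "A_Z M \<Gamma> \<phi> v Z c a"
  have \<zeta>: "smooth_on ?S ?\<zeta>" using assms(9) c by (simp add: local_connection_def)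
  then have S: "open ?S" by (simp add: smooth_on_def)
  note compat = assms(11)[unfolded compatible_volume_def]
  note form = characterising_formD[OF conjunct1[OF compat] c]
  note alt = form(1) and ann = form(3) and diff = smooth_onD(1)[OF form(2) a]
  have insert: "lie_Zv M v Z \<Omega> c a \<xi> = insert_vform ?m ?A (\<Omega> c a) \<xi>" for \<xi>
    by (rule spec[OF bspec[OF bspec[OF conjunct2[OF compat] c] a]])
  obtain y where y: "y \<in> V \<inter> cdom c" "a = totc M c y" using a by blast
  have "fst a \<in> xc c ` bdom M c" using y by (auto simp: totc_def bdom_def)
  then have v: "v c differentiable (at (fst a))"
    using smooth_onD(1) assms(7) c unfolding base_vector_field_def by blast
  have emb: "frechet_derivative (Z_lift ?\<zeta>) (at a) ` D_Z ?\<zeta> a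
      \<subseteq> D_Gam (conn_comp M \<Gamma> c) (Z_lift ?\<zeta> a)"
    using assms(10) c a unfolding embedded_in_def by blast
  have sym: "conn_comp M \<Gamma> c (Z_lift ?\<zeta> a) $ \<sigma> $ i $ j = conn_comp M \<Gamma> c (Z_lift ?\<zeta> a) $ \<sigma> $ j $ i"
    for \<sigma> i j
    unfolding y(2) Z_lift_eq_jc(1)[OF assms(2,9) c y(1)]
    by (rule conn_comp_symmetric[OF assms(3) c Z_lift_eq_jc(2)[OF assms(2,9) c y(1)]])
  note Zv = lie_bracket_Z_v_mem_D_Z[OF smooth_onD(1)[OF \<zeta> a] v emb sym]
  let ?L = "lie_form ?m (Z_v ?\<zeta> (v c)) (\<Omega> c) a"
  \<comment> \<open>Verticality is built into \<open>s_iso\<close>, whose first component is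
    \<open>0\<close> whatever the projector returns.\<close>
  have vertical: "fst (?A w) = 0" for w
    by (simp add: A_Z_def shape_operator_def s_iso_def)
  have "?L \<xi> = vform_trace ?A * \<Omega> c a \<xi>"
  proof (rule slotwise_linear_eqI[where m = ?m and D = "D_Z ?\<zeta> a"
        and B = "range (\<lambda>\<sigma>. (0, axis \<sigma> 1))" and f = ?L
        and g = "\<lambda>\<xi>. vform_trace ?A * \<Omega> c a \<xi>"])
    fix \<xi> \<xi>' :: "nat \<Rightarrow> ('n, 'm) ycoord"
    assume eq: "\<And>i. i < ?m \<Longrightarrow> \<xi> i = \<xi>' i"
    show "?L \<xi> = ?L \<xi>' \<and> vform_trace ?A * \<Omega> c a \<xi> = vform_trace ?A * \<Omega> c a \<xi>'"
      using lie_form_cong[where \<Omega> = "\<Omega> c", OF S a alt eq]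
        alt_form_cong[where f = "\<Omega> c a", OF alt[OF a] eq] by simp
  next
    fix \<xi> :: "nat \<Rightarrow> ('n, 'm) ycoord" and i assume i: "i < ?m"
    show "linear (\<lambda>w. ?L (\<xi>(i := w)))"
      by (rule linear_lie_form_slot[where \<Omega> = "\<Omega> c", OF S a i alt diff Zv(2)])
    show "linear (\<lambda>w. vform_trace ?A * \<Omega> c a (\<xi>(i := w)))"
      using linear_compose_scale_right[OF alt_form_linear[where f = "\<Omega> c a", OF alt[OF a] i]] by simp
    assume D: "\<xi> i \<in> D_Z ?\<zeta> a"
    have "?L \<xi> = 0"
    \<comment> \<open>\<open>U\<close> extends \<open>\<xi> i\<close> to a section of
      \<open>D_Z\<close> with constant base part, for which the bracket with \<open>Z_v\<close> was
      shown to stay in \<open>D_Z\<close>.\<close>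
    proof (rule lie_form_annihilates[where U = "\<lambda>b. (fst (\<xi> i), ?\<zeta> b *v fst (\<xi> i))"
          and D = "D_Z ?\<zeta>" and \<Omega> = "\<Omega> c", OF S a i alt diff ann Zv(3) _ _ Zv(1)])
      show "(fst (\<xi> i), ?\<zeta> b *v fst (\<xi> i)) \<in> D_Z ?\<zeta> b" for b
        by (simp add: D_Z_iff)
      show "(fst (\<xi> i), ?\<zeta> a *v fst (\<xi> i)) = \<xi> i"
        using D by (simp add: D_Z_iff prod_eq_iff)
    qed
    moreover have "\<Omega> c a \<xi> = 0"
      by (rule alt_form_annihilates[where D = "D_Z ?\<zeta> a" and \<xi> = \<xi> and f = "\<Omega> c a",
          OF alt[OF a] ann[OF a] i D])
    ultimately show "?L \<xi> = vform_trace ?A * \<Omega> c a \<xi>" by simp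
  next
    show "span (range (\<lambda>\<sigma>. (0, axis \<sigma> 1)) \<union> D_Z ?\<zeta> a) = UNIV" by (rule span_vertical_D_Z)
  next
    fix \<xi> :: "nat \<Rightarrow> ('n, 'm) ycoord"
    assume "\<And>i. i < ?m \<Longrightarrow> \<xi> i \<in> range (\<lambda>\<sigma>. (0, axis \<sigma> 1))"
    \<comment> \<open>On vertical frames compatibility exchanges the Lie derivative for the
      insertion of the shape operator, which is the trace there.\<close>
    from insert_vform_vertical_frame[OF alt[OF a] vertical this]
    show "?L \<xi> = vform_trace ?A * \<Omega> c a \<xi>"
      by (simp only: insert[unfolded lie_Zv_def])
  qed
  then show "lie_Zv M v Z \<Omega> c a \<xi> = vform_trace ?A * \<Omega> c a \<xi>"
    by (simp add: lie_Zv_def)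
qed

end
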